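(* Let $G=G_{2,f}$ be a Šunić group acting on the binary rooted tree that is non-torsion (i.e. contains an element of infinite order) and not isomorphic to the infinite dihedral group. Then the Frattini subgroup of $G$ (the intersection of all maximal subgroups of $G$) is trivial.
   Context: Let $X=\{\mathbf 0,\mathbf 1\}$ and let $T$ be the binary rooted tree with vertex set $X^*$ (finite words; $w$ is joined to $wx$ for $x\in X$). For $g\in\mathrm{Aut}\,T$ and a vertex $v$, $g_v\in \mathrm{Aut}\,T$ is the unique automorphism with $g(vw)=g(v)g_v(w)$ for all $w$; if $g$ fixes the first level $X$ pointwise, write $\psi(g)=(g_{\mathbf 0},g_{\mathbf 1})$. Šunić groups on the binary tree: let $f(x)=x^m+a_{m-1}x^{m-1}+\dots+a_1x+a_0\in\mathbb F_2[x]$ with $m\ge 1$, $a_0\neq 0$. Let $B\cong(\mathbb Z/2)^m$ be written multiplicatively with basis $b_0,\dots,b_{m-1}$; let $\rho\colon B\to B$ be the automorphism with $\rho(b_i)=b_{i+1}$ for $0\le i\le m-2$ and $\rho(b_{m-1})=b_0^{-a_0}b_1^{-a_1}\cdots b_{m-1}^{-a_{m-1}}$. Let $A=\langle a\rangle$ be of order 2 and $\omega\colon B\to A$ the homomorphism with $\omega(b_i)=1$ for $i\le m-2$ and $\omega(b_{m-1})=a$. Then $a$ acts on $T$ by swapping the first letter ($a(\mathbf 0w)=\mathbf 1w$, $a(\mathbf 1w)=\mathbf 0w$), and $x\in B$ acts recursively by fixing the first level with $\psi(x)=(\omega(x),\rho(x))$. These actions are faithful, and $G_{2,f}:=\langle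 A\cup B\rangle\le\mathrm{Aut}\,T$. *)

theory Defs
  imports
    "HOL-Algebra.Generated_Groups"
    "HOL-Computational_Algebra.Polynomial"
    "HOL-Library.Z2"
begin

section \<open>Maximal subgroups, the Frattini subgroup, the infinite dihedral group\<close>

definition maximal_subgroup :: "'a set \<Rightarrow> ('a, 'b) monoid_scheme \<Rightarrow> bool" where
  "maximal_subgroup M G \<longleftrightarrow>
     subgroup M G \<and> M \<noteq> carrier G \<and>
     (\<forall>H. subgroup H G \<and> M \<subseteq> H \<longrightarrow> H = M \<or> H = carrier G)"

text \<open>Intersecting with the carrier means that a group without maximal subgroups
  is its own Frattini subgroup.\<close>

definition frattini_subgroup :: "('a, 'b) monoid_scheme \<Rightarrow> 'a set" where
  "frattini_subgroup G = carrier G \<inter> \<Inter> {M. maximal_subgroup M G}"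

text \<open>The semidirect product of the integers with a group of order two acting by negation;
  \<open>(k, s)\<close> is the isometry \<open>t \<mapsto> k + t\<close> or, if \<open>s\<close> holds, \<open>t \<mapsto> k - t\<close> of the integers.\<close>

definition infinite_dihedral_group :: "(int \<times> bool) monoid" where
  "infinite_dihedral_group =
     \<lparr>carrier = UNIV,
      monoid.mult = (\<lambda>(k, s) (l, t). (if s then k - l else k + l, s \<noteq> t)),
      one = (0, False)\<rparr>"

lemma group_infinite_dihedral: "group infinite_dihedral_group"
proof (rule groupI)
  fix x assume "x \<in> carrier infinite_dihedral_group"
  show "\<exists>y\<in>carrier infinite_dihedral_group.
          y \<otimes>\<^bsub>infinite_dihedral_group\<^esub> x = \<one>\<^bsub>infinite_dihedral_group\<^esub>"
    by (rule bexI[of _ "(if snd x then fst x else - fst x, snd x)"])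
       (auto simp: infinite_dihedral_group_def split: prod.splits)
qed (auto simp: infinite_dihedral_group_def)


section \<open>The automorphism group of the binary rooted tree\<close>

text \<open>Vertices are words over the alphabet \<open>bool\<close>: \<open>False\<close> is the letter 0
  and \<open>True\<close> is the letter 1.\<close>

type_synonym vertex = "bool list"

definition tree_adj :: "vertex \<Rightarrow> vertex \<Rightarrow> bool" where
  "tree_adj u v \<longleftrightarrow> (\<exists>x. v = u @ [x] \<or> u = v @ [x])"

definition aut_tree :: "(vertex \<Rightarrow> vertex) monoid" where
  "aut_tree =
     \<lparr>carrier = {g. bij g \<and> g [] = [] \<and> (\<forall>u v. tree_adj (g u) (g v) \<longleftrightarrow> tree_adj u v)},
      monoid.mult = (\<circ>),
      one = id\<rparr>"

lemma group_aut_tree: "group aut_tree"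
proof (rule groupI)
  fix g assume "g \<in> carrier aut_tree"
  then have g: "bij g" "g [] = []" "\<And>u v. tree_adj (g u) (g v) \<longleftrightarrow> tree_adj u v"
    by (auto simp: aut_tree_def)
  let ?h = "inv_into UNIV g"
  have gi: "g (?h v) = v" for v
    using g(1) by (simp add: bij_is_surj surj_f_inv_f)
  have "?h [] = []"
    using g(1,2) by (metis bij_inv_eq_iff)
  moreover have "tree_adj (?h u) (?h v) \<longleftrightarrow> tree_adj u v" for u v
    using g(3)[of "?h u" "?h v"] by (simp add: gi)
  ultimately have "?h \<in> carrier aut_tree"
    using g(1) by (simp add: aut_tree_def bij_imp_bij_inv)
  moreover have "?h \<otimes>\<^bsub>aut_tree\<^esub> g = \<one>\<^bsub>aut_tree\<^esub>"
    using g(1) by (simp add: aut_tree_def bij_is_inj)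
  ultimately show "\<exists>h\<in>carrier aut_tree. h \<otimes>\<^bsub>aut_tree\<^esub> g = \<one>\<^bsub>aut_tree\<^esub>"
    by blast
qed (auto simp: aut_tree_def bij_comp comp_assoc)


section \<open>Sunic groups on the binary tree\<close>

text \<open>Over the field \<open>bit\<close> of two elements every nonzero polynomial is monic, so
  \<open>f\<close> is \<open>x ^ m + \<dots> + a 1 * x + a 0\<close> with \<open>m = degree f\<close> and \<open>a i = coeff f i\<close>.\<close>

definition sunic_poly :: "bit poly \<Rightarrow> bool" where
  "sunic_poly f \<longleftrightarrow> degree f \<ge> 1 \<and> coeff f 0 \<noteq> 0"

text \<open>The elementary abelian group with basis \<open>b 0, \<dots>, b (m - 1)\<close> is encoded by
  exponent vectors: \<open>x\<close> stands for the product of the \<open>b i ^ x i\<close> over \<open>i < m\<close>.\<close>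

definition sunic_B :: "bit poly \<Rightarrow> (nat \<Rightarrow> bit) monoid" where
  "sunic_B f =
     \<lparr>carrier = {x. \<forall>i\<ge>degree f. x i = 0},
      monoid.mult = (\<lambda>x y i. x i + y i),
      one = (\<lambda>_. 0)\<rparr>"

definition sunic_b :: "nat \<Rightarrow> nat \<Rightarrow> bit" where
  "sunic_b i = (\<lambda>j. if j = i then 1 else 0)"

definition rho_basis :: "bit poly \<Rightarrow> nat \<Rightarrow> nat \<Rightarrow> bit" where
  "rho_basis f i =
     (if i + 1 < degree f then sunic_b (i + 1)
      else (\<lambda>j. if j < degree f then - coeff f j else 0))"

definition rho :: "bit poly \<Rightarrow> (nat \<Rightarrow> bit) \<Rightarrow> nat \<Rightarrow> bit" where
  "rho f x = (\<lambda>j. \<Sum>i<degree f. x i * rho_basis f i j)"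

text \<open>The value is the exponent of \<open>a\<close>.\<close>

definition omega :: "bit poly \<Rightarrow> (nat \<Rightarrow> bit) \<Rightarrow> bit" where
  "omega f x = x (degree f - 1)"

fun swap_first :: "vertex \<Rightarrow> vertex" where
  "swap_first [] = []"
| "swap_first (c # w) = (\<not> c) # w"

definition act_A :: "bit \<Rightarrow> vertex \<Rightarrow> vertex" where
  "act_A c = (if c = 1 then swap_first else id)"

fun act_B :: "bit poly \<Rightarrow> (nat \<Rightarrow> bit) \<Rightarrow> vertex \<Rightarrow> vertex" where
  "act_B f x [] = []"
| "act_B f x (False # w) = False # act_A (omega f x) w"
| "act_B f x (True # w) = True # act_B f (rho f x) w"

definition sunic_group :: "bit poly \<Rightarrow> (vertex \<Rightarrow> vertex) monoid" where
  "sunic_group f =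
     aut_tree\<lparr>carrier := generate aut_tree (range act_A \<union> act_B f ` carrier (sunic_B f))\<rparr>"


subsection \<open>Well-definedness\<close>

lemma comm_group_sunic_B: "comm_group (sunic_B f)"
proof (rule comm_groupI)
  fix x assume "x \<in> carrier (sunic_B f)"
  then show "\<exists>y\<in>carrier (sunic_B f). y \<otimes>\<^bsub>sunic_B f\<^esub> x = \<one>\<^bsub>sunic_B f\<^esub>"
    by (intro bexI[of _ "\<lambda>i. - x i"]) (auto simp: sunic_B_def simp del: add_bit_eq_xor)
qed (auto simp: sunic_B_def add_ac simp del: add_bit_eq_xor)

lemma rho_closed: "rho f x \<in> carrier (sunic_B f)"
proof -
  have "rho_basis f i j = 0" if "j \<ge> degree f" for i j
    using that by (auto simp: rho_basis_def sunic_b_def)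
  then show ?thesis
    by (simp add: sunic_B_def rho_def)
qed

lemma rho_hom: "rho f \<in> hom (sunic_B f) (sunic_B f)"
proof (rule homI)
  fix x y
  show "rho f (x \<otimes>\<^bsub>sunic_B f\<^esub> y) = rho f x \<otimes>\<^bsub>sunic_B f\<^esub> rho f y"
    by (simp add: sunic_B_def rho_def distrib_right sum.distrib
        del: add_bit_eq_xor mult_bit_eq_and)
qed (rule rho_closed)

lemma rho_sunic_b: "i < degree f \<Longrightarrow> rho f (sunic_b i) = rho_basis f i"
proof
  fix j assume "i < degree f"
  have "rho f (sunic_b i) j = (\<Sum>k<degree f. if k = i then rho_basis f k j else 0)"
    unfolding rho_def by (rule sum.cong) (auto simp: sunic_b_def simp del: mult_bit_eq_and)
  with \<open>i < degree f\<close> show "rho f (sunic_b i) j = rho_basis f i j"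
    by simp
qed

lemma omega_sunic_b: "i < degree f \<Longrightarrow> omega f (sunic_b i) = (if i + 1 < degree f then 0 else 1)"
proof -
  assume "i < degree f"
  then have "degree f - 1 = i \<longleftrightarrow> \<not> i + 1 < degree f" by linarith
  then show ?thesis unfolding omega_def sunic_b_def by presburger
qed

lemma rho_bij:
  assumes "sunic_poly f"
  shows "bij_betw (rho f) (carrier (sunic_B f)) (carrier (sunic_B f))"
proof -
  let ?B = "sunic_B f" and ?m = "degree f"
  have m: "?m \<ge> 1" and a0: "coeff f 0 = 1"
    using assms by (auto simp: sunic_poly_def)
  have val: "rho f x j = (if j = 0 then 0 else x (j - 1)) - x (?m - 1) * coeff f j"
    if "j < ?m" for x j
  proof -
    have "rho f x j = (\<Sum>i\<in>insert (?m - 1) {..<?m - 1}. x i * rho_basis f i j)"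
      unfolding rho_def using m by (intro sum.cong) auto
    also have "\<dots> = x (?m - 1) * rho_basis f (?m - 1) j
        + (\<Sum>i<?m - 1. x i * rho_basis f i j)"
      by (simp del: add_bit_eq_xor mult_bit_eq_and)
    also have "(\<Sum>i<?m - 1. x i * rho_basis f i j)
        = (\<Sum>i<?m - 1. if i + 1 = j then x i else 0)"
      by (rule sum.cong) (auto simp: rho_basis_def sunic_b_def simp del: mult_bit_eq_and)
    also have "\<dots> = (if j = 0 then 0 else x (j - 1))"
    proof (cases j)
      case (Suc k)
      then have "(\<Sum>i<?m - 1. if i + 1 = j then x i else 0)
          = (\<Sum>i<?m - 1. if i = k then x i else 0)"
        by (intro sum.cong) auto
      with Suc that show ?thesis by (simp add: less_diff_conv)
    qed simp
    also have "rho_basis f (?m - 1) j = - coeff f j"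
      using that m by (simp add: rho_basis_def)
    finally show ?thesis
      by (simp add: algebra_simps del: add_bit_eq_xor mult_bit_eq_and)
  qed
  have fin: "finite (carrier ?B)"
  proof (rule finite_subset)
    show "carrier ?B \<subseteq> (\<lambda>S i. if i \<in> S then 1 else 0) ` Pow {..<?m}"
    proof
      fix x assume x: "x \<in> carrier ?B"
      have "{i. x i = 1} \<subseteq> {..<?m}"
        using x by (fastforce simp: sunic_B_def not_le[symmetric])
      moreover have "x = (\<lambda>i. if i \<in> {i. x i = 1} then 1 else 0)"
        by auto
      ultimately show "x \<in> (\<lambda>S i. if i \<in> S then 1 else 0) ` Pow {..<?m}"
        by blast
    qed
  qed simp
  have "inj_on (rho f) (carrier ?B)"
  proof (rule inj_onI)
    fix x y assume x: "x \<in> carrier ?B" and y: "y \<in> carrier ?B" and eq: "rho f x = rho f y"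
    have top: "x (?m - 1) = y (?m - 1)"
      using val[of 0 x] val[of 0 y] m a0 eq
      by (simp del: add_bit_eq_xor mult_bit_eq_and)
    show "x = y"
    proof
      fix i
      consider "i + 1 < ?m" | "i = ?m - 1" | "i \<ge> ?m" by linarith
      then show "x i = y i"
      proof cases
        case 1
        then show ?thesis
          using val[of "i + 1" x] val[of "i + 1" y] eq top
          by (simp del: add_bit_eq_xor mult_bit_eq_and)
      qed (use top x y in \<open>auto simp: sunic_B_def\<close>)
    qed
  qed
  moreover have "rho f ` carrier ?B \<subseteq> carrier ?B"
    using rho_closed by blast
  ultimately show ?thesis
    using fin by (simp add: bij_betw_def endo_inj_surj)
qed

lemma involution_in_aut_tree:
  assumes "\<And>w. g (g w) = w" and "\<And>w. length (g w) = length w"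
    and "\<And>w x. \<exists>y. g (w @ [x]) = g w @ [y]"
  shows "g \<in> carrier aut_tree"
proof -
  have "g [] = []" using assms(2)[of "[]"] by simp
  moreover have "bij g" by (rule involuntory_imp_bij) (rule assms(1))
  moreover have adj: "tree_adj (g u) (g v)" if "tree_adj u v" for u v
    using that assms(3) unfolding tree_adj_def by metis
  moreover have "tree_adj u v" if "tree_adj (g u) (g v)" for u v
    using adj[OF that] by (simp add: assms(1))
  ultimately have "bij g \<and> g [] = [] \<and> (\<forall>u v. tree_adj (g u) (g v) \<longleftrightarrow> tree_adj u v)"
    by blast
  then show ?thesis by (simp add: aut_tree_def)
qed

lemma act_A_in_aut_tree: "act_A c \<in> carrier aut_tree"
proof (rule involution_in_aut_tree)
  show "act_A c (act_A c w) = w" for w by (cases w) (auto simp: act_A_def)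
  show "length (act_A c w) = length w" for w by (cases w) (auto simp: act_A_def)
  show "\<exists>y. act_A c (w @ [x]) = act_A c w @ [y]" for w x by (cases w) (auto simp: act_A_def)
qed

lemma act_B_in_aut_tree: "act_B f x \<in> carrier aut_tree"
proof (rule involution_in_aut_tree)
  have A: "act_A c (act_A c w) = w" "length (act_A c w) = length w" for c w
    by (cases w; auto simp: act_A_def)+
  have A': "\<exists>y. act_A c (w @ [z]) = act_A c w @ [y]" for c w z
    by (cases w) (auto simp: act_A_def)
  show "act_B f x (act_B f x w) = w" for w
    by (induction f x w rule: act_B.induct) (auto simp: A)
  show "length (act_B f x w) = length w" for w
    by (induction f x w rule: act_B.induct) (auto simp: A)
  show "\<exists>y. act_B f x (w @ [z]) = act_B f x w @ [y]" for w z
  proof (induction f x w rule: act_B.induct)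
    case (1 f x)
    show ?case by (cases z) (auto simp: act_A_def)
  qed (use A' in auto)
qed

lemma act_B_hom: "act_B f \<in> hom (sunic_B f) aut_tree"
proof (rule homI)
  fix x y assume "x \<in> carrier (sunic_B f)" "y \<in> carrier (sunic_B f)"
  have "act_B f (\<lambda>i. x i + y i) w = act_B f x (act_B f y w)" for w
  proof (induction w arbitrary: x y)
    case (Cons c w)
    have A: "act_A (s + t) w = act_A s (act_A t w)" for s t
      by (cases w; cases "s = 0"; cases "t = 0") (auto simp: act_A_def)
    have "rho f (\<lambda>i. x i + y i) = (\<lambda>i. rho f x i + rho f y i)"
      by (simp add: rho_def distrib_right sum.distrib del: add_bit_eq_xor mult_bit_eq_and)
    then show ?case
      by (cases c) (use Cons A in \<open>auto simp: omega_def simp del: add_bit_eq_xor\<close>)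
  qed simp
  then show "act_B f (x \<otimes>\<^bsub>sunic_B f\<^esub> y) = act_B f x \<otimes>\<^bsub>aut_tree\<^esub> act_B f y"
    by (auto simp: sunic_B_def aut_tree_def simp del: add_bit_eq_xor)
qed (rule act_B_in_aut_tree)

lemma subgroup_sunic_group: "subgroup (carrier (sunic_group f)) aut_tree"
  unfolding sunic_group_def
  using group.generate_is_subgroup[OF group_aut_tree] act_A_in_aut_tree act_B_in_aut_tree
  by (simp add: image_subset_iff)

lemma group_sunic_group: "group (sunic_group f)"
  using subgroup.subgroup_is_group[OF subgroup_sunic_group group_aut_tree, of f]
  by (simp add: sunic_group_def)

end

theory Submission
  imports Defs
begin

text \<open>Since \<open>G\<close> is not a torsion group, \<open>B\<close> contains an element \<open>\<beta>\<close> with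
  \<open>\<omega>(\<rho>\<^sup>j(\<beta>)) = a\<close> for all \<open>j\<close>, that is \<open>\<beta> = (a, \<beta>)\<close>: otherwise the usual length
  contraction shows that every element has finite order. The translation \<open>\<tau> = a\<beta>\<close> acts freely
  on the orbit \<open>{\<tau>\<^sup>k(111\<dots>)}\<close> of the ray \<open>111\<dots>\<close>, and on each of its points every element of
  \<open>B\<close> acts as the identity or as \<open>\<beta>: k \<mapsto> -k\<close>. Hence for \<open>q \<ge> 2\<close> the stabilizer of
  \<open>{\<tau>\<^sup>k(111\<dots>). q dvd k}\<close> is a subgroup that contains \<open>B\<close> and \<open>\<tau>\<^sup>q\<close> but not \<open>\<tau>\<close>, and by
  Zorn's lemma it lies in a maximal subgroup not containing \<open>\<tau>\<close>.

  On the other hand every nontrivial normal subgroup \<open>N\<close> contains some \<open>\<tau>\<^sup>k\<close> with \<open>k > 0\<close>. For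
  \<open>m \<ge> 2\<close> the group is regular branch over the normal closure \<open>K\<close> of \<open>[a, b\<^bsub>m-1\<^esub>]\<close>, so
  \<open>N\<close> contains a copy of \<open>[K, K]\<close> below some vertex, and \<open>[K, K]\<close> contains a power of \<open>\<tau>\<close>
  below every vertex of the first level. If the Frattini subgroup were nontrivial, the choice
  \<open>q = k + 1\<close> would put \<open>\<tau> = \<tau>\<^sup>q \<tau>\<^sup>-\<^sup>k\<close> into the maximal subgroup above.\<close>

section \<open>Sections of tree automorphisms\<close>

text \<open>\<open>pair\<close> is the inverse of the map psi on the first-level stabilizer.\<close>

fun pair :: "(vertex \<Rightarrow> vertex) \<Rightarrow> (vertex \<Rightarrow> vertex) \<Rightarrow> vertex \<Rightarrow> vertex" where
  "pair g h [] = []"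
| "pair g h (False # w) = False # g w"
| "pair g h (True # w) = True # h w"

lemma pair_comp: "pair g h \<circ> pair g' h' = pair (g \<circ> g') (h \<circ> h')"
proof
  show "(pair g h \<circ> pair g' h') w = pair (g \<circ> g') (h \<circ> h') w" for w
    by (induction g h w rule: pair.induct) auto
qed

lemma pair_id [simp]: "pair id id = id"
proof
  show "pair id id w = id w" for w
    by (induction "id :: vertex \<Rightarrow> vertex" "id :: vertex \<Rightarrow> vertex" w rule: pair.induct) auto
qed

lemma pair_funpow:
  fixes g h :: "vertex \<Rightarrow> vertex"
  shows "pair g h ^^ n = pair (g ^^ n) (h ^^ n)"
  by (induction n) (simp_all only: funpow.simps pair_id pair_comp)

lemma pair_eq_iff [simp]: "pair g h = pair g' h' \<longleftrightarrow> g = g' \<and> h = h'"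
  by (metis ext list.inject pair.simps(2,3))

lemma swap_pair_swap: "swap_first \<circ> pair g h \<circ> swap_first = pair h g"
proof
  show "(swap_first \<circ> pair g h \<circ> swap_first) w = pair h g w" for w
    by (induction h g w rule: pair.induct) auto
qed

lemma swap_swap [simp]: "swap_first (swap_first w) = w"
  by (cases w) auto

lemma swap_comp_swap [simp]: "swap_first \<circ> swap_first = id"
  by auto

lemma act_A_1: "act_A 1 = swap_first" and act_A_0: "act_A 0 = id"
  by (auto simp: act_A_def)

lemma act_A_act_A [simp]: "act_A e (act_A e w) = w"
  by (auto simp: act_A_def)

lemma act_B_eq_pair: "act_B f x = pair (act_A (omega f x)) (act_B f (rho f x))"
proof
  show "act_B f x w = pair (act_A (omega f x)) (act_B f (rho f x)) w" for w
    by (induction f x w rule: act_B.induct) auto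
qed

lemma act_B_act_B [simp]: "act_B f x (act_B f x w) = w"
  by (induction f x w rule: act_B.induct) auto

lemma act_B_comp_act_B [simp]: "act_B f x \<circ> act_B f x = id"
  by auto

section \<open>Elements of infinite order\<close>

definition infinite_order :: "('a \<Rightarrow> 'a) \<Rightarrow> bool" where
  "infinite_order g \<longleftrightarrow> (\<forall>n>0. g ^^ n \<noteq> id)"

lemma funpow_comp_swap: "(g \<circ> h) ^^ n \<circ> g = g \<circ> (h \<circ> g) ^^ n"
  by (induction n) (auto simp: fun_eq_iff funpow_swap1)

lemma infinite_order_comp_swap:
  fixes g h :: "'a \<Rightarrow> 'a"
  assumes "surj g" and "infinite_order (g \<circ> h)"
  shows "infinite_order (h \<circ> g)"
  unfolding infinite_order_def
proof (intro allI impI notI)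
  fix n :: nat
  assume "n > 0" and "(h \<circ> g) ^^ n = id"
  then have "((g \<circ> h) ^^ n) (g w) = g w" for w
    using funpow_comp_swap[where g = g and h = h and n = n] by (simp add: fun_eq_iff)
  then have "(g \<circ> h) ^^ n = id"
    using assms(1) by (metis eq_id_iff surjD)
  with \<open>n > 0\<close> assms(2) show False
    by (auto simp: infinite_order_def)
qed

lemma infinite_order_conj_involution:
  assumes "g \<circ> g = id" and "infinite_order (g \<circ> h \<circ> g)"
  shows "infinite_order h"
proof -
  have "surj g"
    using assms(1) by (intro surjI[of g g]) (simp add: fun_eq_iff)
  then have "infinite_order (h \<circ> g \<circ> g)"
    using assms(2) infinite_order_comp_swap[of g "h \<circ> g"] by (simp add: comp_assoc)
  with assms(1) show ?thesis
    by (simp add: comp_assoc)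
qed

lemma funpow_double: "g ^^ (2 * n) = (g \<circ> g) ^^ n"
  by (simp only: funpow_mult[symmetric] numeral_2_eq_2) simp

lemma infinite_order_double: "infinite_order g \<Longrightarrow> infinite_order (g \<circ> g)"
  unfolding infinite_order_def
proof (intro allI impI)
  fix n :: nat
  assume g: "\<forall>n>0. g ^^ n \<noteq> id" and "n > 0"
  then have "g ^^ (2 * n) \<noteq> id" by simp
  then show "(g \<circ> g) ^^ n \<noteq> id"
    by (simp only: funpow_double not_False_eq_True)
qed

lemma funpow_mult_eq_id: "g ^^ m = id \<Longrightarrow> g ^^ (m * n) = id"
  by (simp add: funpow_mult[symmetric] id_funpow)

lemma not_infinite_orderI: "n > 0 \<Longrightarrow> g ^^ n = id \<Longrightarrow> \<not> infinite_order g"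
  by (auto simp: infinite_order_def)

lemma infinite_order_if_double:
  fixes g :: "'a \<Rightarrow> 'a"
  assumes "infinite_order (g \<circ> g)"
  shows "infinite_order g"
  unfolding infinite_order_def
proof (intro allI impI notI)
  fix n :: nat
  assume "n > 0" and "g ^^ n = id"
  then have "g ^^ (2 * n) = id"
    using funpow_mult_eq_id[of n g 2] by (simp only: mult.commute)
  then have "(g \<circ> g) ^^ n = id"
    by (simp only: funpow_double)
  with \<open>n > 0\<close> assms show False
    by (auto simp: infinite_order_def)
qed

lemma funpow_conj_involution:
  assumes "g \<circ> g = id"
  shows "(g \<circ> h \<circ> g) ^^ n = g \<circ> h ^^ n \<circ> g"
proof (induction n)
  case 0
  show ?case using assms by simp
next
  case (Suc n)
  have "g (g w) = w" for w
    using assms by (simp add: fun_eq_iff)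
  then show ?case
    unfolding funpow.simps Suc by auto
qed

lemma infinite_order_pair:
  assumes "infinite_order (pair g h)"
  shows "infinite_order g \<or> infinite_order h"
proof (rule ccontr)
  assume "\<not> ?thesis"
  then obtain m n where "m > 0" "n > 0" "g ^^ m = id" "h ^^ n = id"
    by (auto simp: infinite_order_def)
  then have "pair g h ^^ (m * n) = id"
    using funpow_mult_eq_id[of m g n] funpow_mult_eq_id[of n h m]
    by (simp add: pair_funpow mult.commute)
  with \<open>m > 0\<close> \<open>n > 0\<close> assms show False
    by (auto simp: infinite_order_def)
qed

section \<open>Non-torsion Sunic groups contain a directed involution that swaps on every level\<close>

definition syllable :: "bit poly \<Rightarrow> (nat \<Rightarrow> bit) \<times> bit \<Rightarrow> vertex \<Rightarrow> vertex" where
  "syllable f p = act_B f (fst p) \<circ> act_A (snd p)"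

definition word :: "bit poly \<Rightarrow> ((nat \<Rightarrow> bit) \<times> bit) list \<Rightarrow> vertex \<Rightarrow> vertex" where
  "word f ps = foldr (\<lambda>p g. syllable f p \<circ> g) ps id"

lemma word_Nil [simp]: "word f [] = id"
  and word_Cons [simp]: "word f (p # ps) = syllable f p \<circ> word f ps"
  by (simp_all add: word_def)

lemma word_append [simp]: "word f (ps @ qs) = word f ps \<circ> word f qs"
  by (induction ps) (auto simp: comp_assoc)

lemma surj_syllable: "surj (syllable f p)"
  unfolding syllable_def by (rule surjI[of _ "act_A (snd p) \<circ> act_B f (fst p)"]) simp

lemma surj_word: "surj (word f ps)"
  proof (induction ps)
  case (Cons p ps)
  then show ?case unfolding word_Cons by (rule comp_surj[OF _ surj_syllable])
qed simp

section \<open>Alternating words and their sections at the letter 1\<close>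

abbreviation alternating :: "bit poly \<Rightarrow> (nat \<Rightarrow> bit) list \<Rightarrow> vertex \<Rightarrow> vertex" where
  "alternating f xs \<equiv> word f (map (\<lambda>x. (x, 1)) xs)"

fun evens :: "'a list \<Rightarrow> 'a list" and odds :: "'a list \<Rightarrow> 'a list" where
  "evens [] = []"
| "evens (x # xs) = x # odds xs"
| "odds [] = []"
| "odds (x # xs) = evens xs"

lemma evens_odds_append:
  "evens (xs @ ys) = evens xs @ (if even (length xs) then evens ys else odds ys)"
  "odds (xs @ ys) = odds xs @ (if even (length xs) then odds ys else evens ys)"
  by (induction xs) auto

lemma set_evens_Un_odds: "set (evens xs) \<union> set (odds xs) = set xs"
  by (induction xs) auto

lemma length_evens_odds:
  "length (evens xs) = (length xs + 1) div 2" "length (odds xs) = length xs div 2"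
  by (induction xs) auto

text \<open>A block \<open>x a y a\<close> is the product of \<open>x\<close> and the conjugate of
  \<open>y\<close> by \<open>a\<close>, so its section at the letter 1 is the syllable
  \<open>(rho f x, omega f y)\<close>. Each block of two syllables thus contributes one.\<close>

definition halve :: "bit poly \<Rightarrow> (nat \<Rightarrow> bit) list \<Rightarrow> ((nat \<Rightarrow> bit) \<times> bit) list" where
  "halve f xs = zip (map (rho f) (evens xs)) (map (omega f) (odds xs))"

lemma alternating_eq_pair:
  "even (length xs) \<Longrightarrow> \<exists>g :: vertex \<Rightarrow> vertex. alternating f xs = pair g (word f (halve f xs))"
proof (induction xs rule: induct_list012)
  case (3 x y zs)
  then obtain g where g: "alternating f zs = pair g (word f (halve f zs))"
    by auto
  have "alternating f (x # y # zs)
      = act_B f x \<circ> (swap_first \<circ> act_B f y \<circ> swap_first) \<circ> alternating f zs"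
    by (simp add: syllable_def act_A_1 comp_assoc)
  also have "\<dots> = pair (act_A (omega f x) \<circ> act_B f (rho f y) \<circ> g)
      (act_B f (rho f x) \<circ> act_A (omega f y) \<circ> word f (halve f zs))"
    unfolding act_B_eq_pair[of f x] act_B_eq_pair[of f y] swap_pair_swap pair_comp g ..
  also have "act_B f (rho f x) \<circ> act_A (omega f y) \<circ> word f (halve f zs)
      = word f (halve f (x # y # zs))"
    by (simp add: halve_def syllable_def)
  finally show ?case
    by blast
next
  case 1
  have "alternating f [] = pair id (word f (halve f []))"
    by (simp only: list.map word_Nil halve_def evens.simps odds.simps zip_Nil pair_id)
  then show ?case by blast
qed auto

text \<open>The section at the other letter is conjugate to the corresponding section of the
  cyclically rotated word.\<close>

lemma infinite_order_halve:
  assumes "even (length xs)" and "infinite_order (alternating f xs)"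
  shows "infinite_order (word f (halve f xs)) \<or> infinite_order (word f (halve f (rotate1 xs)))"
proof (cases xs)
  case Nil
  then show ?thesis using assms by (simp add: halve_def)
next
  case (Cons x ys)
  obtain g where g: "alternating f xs = pair g (word f (halve f xs))"
    using alternating_eq_pair assms(1) by blast
  obtain h where h: "alternating f (rotate1 xs) = pair h (word f (halve f (rotate1 xs)))"
    using alternating_eq_pair[of "rotate1 xs"] assms(1) by auto
  have "alternating f (rotate1 xs)
      = swap_first \<circ> (act_B f x \<circ> alternating f xs \<circ> act_B f x) \<circ> swap_first"
    using Cons by (auto simp: fun_eq_iff syllable_def act_A_1)
  also have "\<dots> = pair (act_B f (rho f x) \<circ> word f (halve f xs) \<circ> act_B f (rho f x))
      (act_A (omega f x) \<circ> g \<circ> act_A (omega f x))"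
    unfolding g act_B_eq_pair[of f x] swap_pair_swap pair_comp ..
  finally have "word f (halve f (rotate1 xs)) = act_A (omega f x) \<circ> g \<circ> act_A (omega f x)"
    using h by simp
  then have "act_A (omega f x) \<circ> word f (halve f (rotate1 xs)) \<circ> act_A (omega f x) = g"
    by (auto simp: fun_eq_iff)
  moreover have "act_A (omega f x) \<circ> act_A (omega f x) = id"
    by auto
  ultimately show ?thesis
    using infinite_order_pair assms(2) g infinite_order_conj_involution by metis
qed

lemma act_B_add:
  assumes "x \<in> carrier (sunic_B f)" "y \<in> carrier (sunic_B f)"
  shows "act_B f x \<circ> act_B f y = act_B f (x \<otimes>\<^bsub>sunic_B f\<^esub> y)"
  using hom_mult[OF act_B_hom assms] by (simp add: aut_tree_def)

lemma sunic_B_closed: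
  assumes "x \<in> carrier (sunic_B f)" "y \<in> carrier (sunic_B f)"
  shows "x \<otimes>\<^bsub>sunic_B f\<^esub> y \<in> carrier (sunic_B f)"
  using assms comm_group_sunic_B by (meson comm_group.axioms(1) comm_monoid.axioms(1) monoid.m_closed)

lemma zero_in_sunic_B: "(\<lambda>_. 0) \<in> carrier (sunic_B f)"
  by (simp add: sunic_B_def)

lemma rho_zero: "rho f (\<lambda>_. 0) = (\<lambda>_. 0)"
  by (simp add: rho_def)

lemma act_B_zero [simp]: "act_B f (\<lambda>_. 0) = id"
proof -
  have "act_B f (\<lambda>_. 0) w = w" for w
  proof (induction w)
    case (Cons e w)
    then show ?case by (cases e) (auto simp: rho_zero omega_def act_A_0)
  qed simp
  then show ?thesis by auto
qed

text \<open>A cyclic rotation, which is a conjugation, puts the syllable without \<open>a\<close> in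
  front, where it merges into the next syllable. If there is no next syllable, the element squares
  to the identity, against infinite order.\<close>

lemma shorten_word:
  assumes "infinite_order (word f ps)" and "set ps \<subseteq> carrier (sunic_B f) \<times> UNIV"
    and "0 \<in> snd ` set ps"
  shows "\<exists>qs. length qs < length ps \<and> set qs \<subseteq> carrier (sunic_B f) \<times> UNIV
    \<and> infinite_order (word f qs)"
proof -
  obtain x where "(x, 0) \<in> set ps"
    using assms(3) by auto
  then obtain us vs where ps: "ps = us @ (x, 0) # vs"
    by (meson split_list)
  have "infinite_order (word f us \<circ> word f ((x, 0) # vs))"
    using assms(1) ps by simp
  from infinite_order_comp_swap[OF surj_word this]
  have inf: "infinite_order (act_B f x \<circ> word f (vs @ us))"
    by (simp add: syllable_def act_A_0 comp_assoc)
  show ?thesis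
  proof (cases "vs @ us")
    case Nil
    have "(act_B f x) ^^ 2 = id"
      by (simp add: numeral_2_eq_2)
    with inf Nil show ?thesis
      by (auto simp: infinite_order_def)
  next
    case (Cons p rs)
    let ?q = "(x \<otimes>\<^bsub>sunic_B f\<^esub> fst p, snd p)"
    have "p \<in> set (vs @ us)" "set rs \<subseteq> set (vs @ us)"
      using Cons by auto
    then have "p \<in> set ps" "set rs \<subseteq> set ps"
      using ps by auto
    then have mem: "fst p \<in> carrier (sunic_B f)" "x \<in> carrier (sunic_B f)"
      "set rs \<subseteq> carrier (sunic_B f) \<times> UNIV"
      using assms(2) ps by auto
    then have "act_B f x \<circ> word f (vs @ us) = word f (?q # rs)"
      unfolding Cons by (simp add: syllable_def act_B_add[symmetric] comp_assoc)
    moreover have "length (?q # rs) < length ps"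
      using arg_cong[OF Cons, of length] ps by simp
    ultimately show ?thesis
      using inf mem sunic_B_closed by (intro exI[of _ "?q # rs"]) auto
  qed
qed

lemma alternating_if_no_zero:
  assumes "0 \<notin> snd ` set ps"
  shows "ps = map (\<lambda>x. (x, 1 :: bit)) (map fst ps)"
proof -
  have "snd p = 1" if "p \<in> set ps" for p
  proof -
    have "snd p \<noteq> 0"
      using assms that by force
    then show ?thesis by simp
  qed
  then have "map (\<lambda>p. (fst p, 1)) ps = ps"
    by (intro map_idI) (simp add: prod_eq_iff)
  then show ?thesis
    by (simp add: comp_def)
qed

text \<open>The second copy of \<open>xs\<close> starts at an odd position, so the even and the odd
  positions of \<open>xs @ xs\<close> each run through all letters of \<open>xs\<close>. Squaring
  followed by halving therefore keeps the length.\<close>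

lemma halve_props:
  assumes "odd (length xs)"
  shows "length (halve f (xs @ xs)) = length xs"
    and "fst ` set (halve f (xs @ xs)) = rho f ` set xs"
    and "snd ` set (halve f (xs @ xs)) = omega f ` set xs"
proof -
  have len: "length (evens (xs @ xs)) = length xs" "length (odds (xs @ xs)) = length xs"
    by (simp_all add: length_evens_odds)
  then show "length (halve f (xs @ xs)) = length xs"
    by (simp add: halve_def)
  have ev: "set (evens (xs @ xs)) = set xs" and od: "set (odds (xs @ xs)) = set xs"
    using assms set_evens_Un_odds[of xs] by (auto simp: evens_odds_append)
  have "fst ` set (halve f (xs @ xs)) = set (map fst (halve f (xs @ xs)))"
    by (rule set_map[symmetric])
  also have "map fst (halve f (xs @ xs)) = map (rho f) (evens (xs @ xs))"
    unfolding halve_def by (rule map_fst_zip) (simp add: len)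
  finally show "fst ` set (halve f (xs @ xs)) = rho f ` set xs"
    by (simp add: ev)
  have "snd ` set (halve f (xs @ xs)) = set (map snd (halve f (xs @ xs)))"
    by (rule set_map[symmetric])
  also have "map snd (halve f (xs @ xs)) = map (omega f) (odds (xs @ xs))"
    unfolding halve_def by (rule map_snd_zip) (simp add: len)
  finally show "snd ` set (halve f (xs @ xs)) = omega f ` set xs"
    by (simp add: od)
qed

text \<open>Take a word of least length \<open>k\<close> among those of infinite order. Halving
  rules out even \<open>k\<close>; for odd \<open>k\<close>, squaring and halving gives another word
  of length \<open>k\<close>, with letters moved by \<open>rho f\<close> and exponents read off by
  \<open>omega f\<close>. Minimality forces these exponents to be 1, and the step can be repeated
  forever.\<close>

lemma ex_always_swapping_if_infinite_order_word:
  assumes "infinite_order (word f ps)" and "set ps \<subseteq> carrier (sunic_B f) \<times> UNIV"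
  shows "\<exists>x\<in>carrier (sunic_B f). \<forall>j. omega f ((rho f ^^ j) x) = 1"
proof -
  let ?B = "carrier (sunic_B f)"
  define P where "P = (\<lambda>k. \<exists>ps. length ps = k \<and> set ps \<subseteq> ?B \<times> UNIV \<and> infinite_order (word f ps))"
  define k where "k = (LEAST k. P k)"
  have "P k"
    unfolding k_def by (rule LeastI[of P "length ps"]) (use assms in \<open>auto simp: P_def\<close>)
  have min: "0 \<notin> snd ` set qs"
    if qs: "length qs = k" "set qs \<subseteq> ?B \<times> UNIV" "infinite_order (word f qs)" for qs
  proof
    assume "0 \<in> snd ` set qs"
    then obtain rs where rs: "length rs < k" "set rs \<subseteq> ?B \<times> UNIV" "infinite_order (word f rs)"
      using shorten_word[OF qs(3,2)] qs(1) by blast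
    then have "P (length rs)"
      unfolding P_def by blast
    with rs(1) show False
      using not_less_Least[of "length rs" P] by (simp add: k_def)
  qed
  define Q where "Q = (\<lambda>xs. length xs = k \<and> set xs \<subseteq> ?B \<and> infinite_order (alternating f xs))"
  have Q: "Q (map fst qs)"
    if "length qs = k" "set qs \<subseteq> ?B \<times> UNIV" "infinite_order (word f qs)" for qs
  proof -
    have "alternating f (map fst qs) = word f qs"
      by (rule arg_cong[OF alternating_if_no_zero[OF min[OF that]], symmetric])
    moreover have "set (map fst qs) \<subseteq> ?B"
      using that(2) by auto
    ultimately show ?thesis
      using that unfolding Q_def by simp
  qed
  obtain xs where xs: "Q xs"
    using \<open>P k\<close> Q unfolding P_def by blast
  then have len: "length xs = k" "infinite_order (alternating f xs)"
    unfolding Q_def by auto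
  have halve_B: "set (halve f zs) \<subseteq> ?B \<times> UNIV" for zs
    using rho_closed by (auto simp: halve_def dest!: set_zip_leftD)
  have "odd k"
  proof
    assume "even k"
    then obtain zs where "infinite_order (word f (halve f zs))" "length zs = k"
      using infinite_order_halve[of xs f] len by auto
    moreover have "length (halve f zs) = k div 2"
      using \<open>length zs = k\<close> by (simp add: halve_def length_evens_odds)
    ultimately have "P (k div 2)"
      using halve_B unfolding P_def by blast
    then have "k \<le> k div 2"
      unfolding k_def by (rule Least_le)
    then have "k = 0" by simp
    then show False
      using len by (auto simp: infinite_order_def)
  qed
  have step: "(\<forall>y\<in>set ys. omega f y = 1) \<and> (\<exists>zs. Q zs \<and> set zs = rho f ` set ys)"
    if "Q ys" for ys
  proof -
    have ys: "length ys = k" "infinite_order (alternating f ys)"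
      using that unfolding Q_def by auto
    then have "infinite_order (alternating f (ys @ ys))"
      using infinite_order_double by auto
    \<comment> \<open>Rotating a doubled list doubles the rotated list, so whichever section has
      infinite order is again the half of a doubled word.\<close>
    moreover have "rotate1 (ys @ ys) = rotate1 ys @ rotate1 ys"
      by (cases ys) auto
    ultimately obtain us where us: "us = ys \<or> us = rotate1 ys"
      "infinite_order (word f (halve f (us @ us)))"
      using infinite_order_halve[of "ys @ ys" f] by auto
    then have "set us = set ys" "length us = k"
      using ys by auto
    note halve = halve_props[of us f, unfolded this, OF \<open>odd k\<close>]
    have "0 \<notin> omega f ` set ys"
      using min[OF halve(1) halve_B us(2)] halve(3) by simp
    moreover have "Q (map fst (halve f (us @ us)))"
      by (rule Q[OF halve(1) halve_B us(2)])
    moreover have "set (map fst (halve f (us @ us))) = rho f ` set ys"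
      using halve(2) by simp
    moreover have "omega f y = 1" if "omega f y \<noteq> 0" for y
      using that by simp
    ultimately show ?thesis
      by (metis image_eqI)
  qed
  have iter: "\<exists>ys. Q ys \<and> set ys = (rho f ^^ j) ` set xs" for j
  proof (induction j)
    case (Suc j)
    then obtain ys where "Q ys" "set ys = (rho f ^^ j) ` set xs" by blast
    moreover have "rho f ` (rho f ^^ j) ` set xs = (rho f ^^ Suc j) ` set xs"
      by (simp add: image_comp)
    ultimately show ?case using step[of ys] by metis
  next
    case 0
    show ?case using xs by (intro exI[of _ xs]) simp
  qed
  have "k > 0"
    using \<open>odd k\<close> by (rule odd_pos)
  then obtain x where x: "x \<in> set xs"
    using len by (cases xs) auto
  have "omega f ((rho f ^^ j) x) = 1" for j
  proof -
    obtain ys where "Q ys" "set ys = (rho f ^^ j) ` set xs"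
      using iter by blast
    then show ?thesis
      using step[of ys] x by auto
  qed
  moreover have "x \<in> ?B"
    using x xs unfolding Q_def by auto
  ultimately show ?thesis by blast
qed

section \<open>Normal subgroups of Sunic groups\<close>

text \<open>The recursion reads \<open>x\<close> only through the bits
  \<open>omega f ((rho f ^^ j) x)\<close>, one for each vertex of the ray 111... of the
  tree.\<close>

lemma act_B_cong:
  assumes "\<And>j. omega f ((rho f ^^ j) x) = omega f ((rho f ^^ j) y)"
  shows "act_B f x = act_B f y"
proof
  fix w
  show "act_B f x w = act_B f y w"
    using assms
  proof (induction w arbitrary: x y)
    case (Cons a w)
    have "omega f ((rho f ^^ j) (rho f x)) = omega f ((rho f ^^ j) (rho f y))" for j
      using Cons.prems[of "Suc j"] by (simp add: funpow_swap1)
    then have "act_B f (rho f x) w = act_B f (rho f y) w"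
      by (rule Cons.IH)
    then show ?case
      using Cons.prems[of 0] by (cases a) simp_all
  qed simp
qed

lemma finite_sunic_B: "finite (carrier (sunic_B f))"
proof (rule finite_subset)
  let ?A = "{..<degree f}"
  show "carrier (sunic_B f) \<subseteq> {x. \<forall>i. (i \<in> ?A \<longrightarrow> x i \<in> {0, 1 :: bit}) \<and> (i \<notin> ?A \<longrightarrow> x i = 0)}"
    by (auto simp: sunic_B_def)
  show "finite {x. \<forall>i. (i \<in> ?A \<longrightarrow> x i \<in> {0, 1 :: bit}) \<and> (i \<notin> ?A \<longrightarrow> x i = 0)}"
    by (rule finite_set_of_finite_funs) auto
qed

section \<open>The group of a fixed polynomial: generators, inverses, words\<close>

locale sunic =
  fixes f :: "bit poly"
  assumes poly: "sunic_poly f"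
begin

abbreviation "B \<equiv> carrier (sunic_B f)"
abbreviation "G \<equiv> carrier (sunic_group f)"
abbreviation "inv_G \<equiv> m_inv (sunic_group f)"

sublocale G: group "sunic_group f"
  rewrites "monoid.mult (sunic_group f) = (\<circ>)" and "one (sunic_group f) = id"
  using group_sunic_group by (auto simp: sunic_group_def aut_tree_def)

lemma gens_in_G: "swap_first \<in> G" "x \<in> B \<Longrightarrow> act_B f x \<in> G"
proof -
  have "swap_first \<in> range act_A"
    using act_A_1 by (metis rangeI)
  then show "swap_first \<in> G" "x \<in> B \<Longrightarrow> act_B f x \<in> G"
    by (auto simp: sunic_group_def intro!: generate.incl)
qed

lemma one_eq_id: "\<one>\<^bsub>sunic_group f\<^esub> = id"
  by (simp add: sunic_group_def aut_tree_def)

text \<open>The generators are involutions or trivial, so every element is a product of generators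
  and no case for inverses arises.\<close>

lemma sunic_induct [consumes 1, case_names id swap act_B]:
  assumes "g \<in> G"
    and "P id"
    and "\<And>g. g \<in> G \<Longrightarrow> P g \<Longrightarrow> P (swap_first \<circ> g)"
    and "\<And>x g. x \<in> B \<Longrightarrow> g \<in> G \<Longrightarrow> P g \<Longrightarrow> P (act_B f x \<circ> g)"
  shows "P g"
proof -
  let ?S = "range act_A \<union> act_B f ` B"
  have gen: "P (s \<circ> g)" if "s \<in> ?S" "g \<in> G" "P g" for s g
    using that assms(3,4) by (auto simp: act_A_def)
  have gen_inv: "m_inv aut_tree s = s" if "s \<in> ?S" for s
  proof (rule group.inv_equality[OF group_aut_tree])
    show "s \<otimes>\<^bsub>aut_tree\<^esub> s = \<one>\<^bsub>aut_tree\<^esub>"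
      using that by (auto simp: aut_tree_def act_A_def)
    show "s \<in> carrier aut_tree" "s \<in> carrier aut_tree"
      using that act_A_in_aut_tree act_B_in_aut_tree by auto
  qed
  have "\<forall>h\<in>G. P h \<longrightarrow> P (g \<circ> h)"
    if "g \<in> generate aut_tree ?S" for g
    using that
  proof (induction rule: generate.induct)
    case one
    then show ?case by (simp add: aut_tree_def)
  next
    case (incl s)
    then show ?case using gen by blast
  next
    case (inv s)
    then show ?case using gen unfolding gen_inv[OF inv] by blast
  next
    case (eng g h)
    have "h \<in> G"
      using eng.hyps by (simp add: sunic_group_def)
    then have "h \<circ> k \<in> G" if "k \<in> G" for k
      using that by (rule G.m_closed)
    moreover have gh: "g \<otimes>\<^bsub>aut_tree\<^esub> h = g \<circ> h"
      by (simp add: aut_tree_def)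
    ultimately show ?case
      using eng.IH unfolding gh comp_assoc by blast
  qed
  moreover have "g \<in> generate aut_tree ?S"
    using assms(1) by (simp add: sunic_group_def)
  ultimately have "P (g \<circ> id)"
    using G.one_closed assms(2) by blast
  then show ?thesis by simp
qed

lemma inv_G_apply [simp]: "g \<in> G \<Longrightarrow> g (inv_G g w) = w" "g \<in> G \<Longrightarrow> inv_G g (g w) = w"
  using G.r_inv G.l_inv by (metis comp_apply id_apply)+

lemma inv_G_eqI: "g \<in> G \<Longrightarrow> h \<circ> g = id \<Longrightarrow> inv_G g = h"
  by (rule ext) (metis comp_apply id_apply inv_G_apply(1))

lemma inv_swap: "inv_G swap_first = swap_first"
  and inv_act_B: "x \<in> B \<Longrightarrow> inv_G (act_B f x) = act_B f x"
  by (simp_all add: inv_G_eqI gens_in_G)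

lemma apply_take:
  assumes "g \<in> G"
  shows "g (take n w) = take n (g w)"
  using assms
proof (induction arbitrary: w rule: sunic_induct)
  case (swap g)
  have "swap_first (take n v) = take n (swap_first v)" for v
    by (cases v; cases n) auto
  then show ?case using swap by simp
next
  case (act_B x g)
  have "act_B f x (take n v) = take n (act_B f x v)" for x v
  proof (induction n arbitrary: x v)
    case (Suc n)
    have "act_A e (take n u) = take n (act_A e u)" for e u
      by (cases u; cases n) (auto simp: act_A_def)
    with Suc show ?case
      by (cases v; cases "hd v") auto
  qed simp
  then show ?case using act_B by simp
qed simp

lemma apply_Nil [simp]: "g \<in> G \<Longrightarrow> g [] = []"
  using apply_take[of g 0 "[]"] by simp

lemma nat_pow_eq_funpow: "g [^]\<^bsub>sunic_group f\<^esub> (n :: nat) = g ^^ n"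
  by (induction n) (simp_all only: G.nat_pow_0 G.nat_pow_Suc funpow.simps(1) funpow_Suc_right)

lemma funpow_closed: "g \<in> G \<Longrightarrow> g ^^ n \<in> G"
  using G.nat_pow_closed[of g n] by (simp add: nat_pow_eq_funpow)

lemma ex_word:
  assumes "g \<in> G"
  shows "\<exists>ps. g = word f ps \<and> set ps \<subseteq> B \<times> UNIV"
  using assms
proof (induction rule: sunic_induct)
  case id
  show ?case by (rule exI[of _ "[]"]) simp
next
  case (swap g)
  then obtain ps where "g = word f ps" "set ps \<subseteq> B \<times> UNIV" by blast
  then show ?case
    by (intro exI[of _ "((\<lambda>_. 0), 1) # ps"]) (simp add: syllable_def act_A_1 zero_in_sunic_B)
next
  case (act_B x g)
  then obtain ps where "g = word f ps" "set ps \<subseteq> B \<times> UNIV" by blast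
  with act_B show ?case
    by (intro exI[of _ "(x, 0) # ps"]) (simp add: syllable_def act_A_0)
qed

lemma ex_always_swapping:
  assumes "\<exists>g\<in>G. \<forall>n::nat. n > 0 \<longrightarrow> g [^]\<^bsub>sunic_group f\<^esub> n \<noteq> \<one>\<^bsub>sunic_group f\<^esub>"
  shows "\<exists>x\<in>B. \<forall>j. omega f ((rho f ^^ j) x) = 1"
proof -
  obtain g where "g \<in> G" "infinite_order g"
    using assms unfolding infinite_order_def nat_pow_eq_funpow one_eq_id by blast
  then show ?thesis
    using ex_word ex_always_swapping_if_infinite_order_word by metis
qed

lemma normalI:
  assumes "N \<subseteq> G" "id \<in> N" "\<And>x y. x \<in> N \<Longrightarrow> y \<in> N \<Longrightarrow> x \<circ> y \<in> N"
    and "\<And>x. x \<in> N \<Longrightarrow> inv_G x \<in> N"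
    and "\<And>g x. g \<in> G \<Longrightarrow> x \<in> N \<Longrightarrow> g \<circ> x \<circ> inv_G g \<in> N"
  shows "N \<lhd> sunic_group f"
  unfolding G.normal_inv_iff using assms by (auto intro!: G.subgroupI)

lemma normalD:
  assumes "N \<lhd> sunic_group f"
  shows "x \<in> N \<Longrightarrow> x \<in> G" and "id \<in> N" and "x \<in> N \<Longrightarrow> y \<in> N \<Longrightarrow> x \<circ> y \<in> N"
    and "x \<in> N \<Longrightarrow> inv_G x \<in> N" and "g \<in> G \<Longrightarrow> x \<in> N \<Longrightarrow> g \<circ> x \<circ> inv_G g \<in> N"
proof -
  have N: "subgroup N (sunic_group f)"
    and conj: "\<And>g x. g \<in> G \<Longrightarrow> x \<in> N \<Longrightarrow> g \<circ> x \<circ> inv_G g \<in> N"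
    using assms unfolding G.normal_inv_iff by blast+
  show "x \<in> N \<Longrightarrow> x \<in> G" "x \<in> N \<Longrightarrow> y \<in> N \<Longrightarrow> x \<circ> y \<in> N" "x \<in> N \<Longrightarrow> inv_G x \<in> N"
    using G.subgroupE[OF N] by blast+
  show "id \<in> N"
    using subgroup.one_closed[OF N] by (simp only: one_eq_id)
  show "g \<in> G \<Longrightarrow> x \<in> N \<Longrightarrow> g \<circ> x \<circ> inv_G g \<in> N"
    by (rule conj)
qed

lemma normal_conj_swap: "N \<lhd> sunic_group f \<Longrightarrow> x \<in> N \<Longrightarrow> swap_first \<circ> x \<circ> swap_first \<in> N"
  using normalD(5)[of N swap_first x] by (simp add: inv_swap gens_in_G)

lemma normal_commutator:
  assumes "N \<lhd> sunic_group f" "x \<in> N" "g \<in> G"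
  shows "x \<circ> g \<circ> inv_G x \<circ> inv_G g \<in> N"
proof -
  have "x \<circ> (g \<circ> inv_G x \<circ> inv_G g) \<in> N"
    using assms(3) by (intro normalD(3,5)[OF assms(1)] normalD(4)[OF assms(1)] assms(2))
  then show ?thesis by (simp only: comp_assoc)
qed

section \<open>Self-replication and sections of normal subgroups\<close>

lemma ex_omega_1: "\<exists>x\<in>B. omega f x = 1"
  using poly omega_sunic_b[of "degree f - 1" f]
  by (intro bexI[of _ "sunic_b (degree f - 1)"]) (auto simp: sunic_poly_def sunic_B_def sunic_b_def)

text \<open>Some element of \<open>B\<close> has first section \<open>a\<close>, and every element
  of \<open>B\<close> is the first section of a conjugate by \<open>a\<close>, because
  \<open>rho f\<close> is onto. Hence the first-level stabilizer projects onto
  \<open>G\<close>.\<close>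

lemma self_replicating:
  assumes "g \<in> G"
  shows "\<exists>h. pair g h \<in> G"
  using assms
proof (induction rule: sunic_induct)
  case id
  show ?case using G.one_closed pair_id by metis
next
  case (swap g)
  then obtain h where h: "pair g h \<in> G" by blast
  obtain x where x: "x \<in> B" "omega f x = 1"
    using ex_omega_1 by blast
  then have "act_B f x \<circ> pair g h \<in> G"
    using gens_in_G h by (intro G.m_closed)
  then have "pair (swap_first \<circ> g) (act_B f (rho f x) \<circ> h) \<in> G"
    unfolding act_B_eq_pair[of f x] pair_comp x(2) act_A_1 .
  then show ?case by blast
next
  case (act_B x g)
  then obtain h where h: "pair g h \<in> G" by blast
  obtain y where y: "y \<in> B" "x = rho f y"
    using rho_bij[OF poly] act_B.hyps(1) by (metis bij_betw_imp_surj_on imageE)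
  have "(swap_first \<circ> act_B f y \<circ> swap_first) \<circ> pair g h \<in> G"
    using gens_in_G h y by (intro G.m_closed)
  then have "pair (act_B f x \<circ> g) (act_A (omega f y) \<circ> h) \<in> G"
    unfolding act_B_eq_pair[of f y] swap_pair_swap pair_comp y(2)[symmetric] .
  then show ?case by blast
qed

text \<open>Only elements of \<open>N\<close> supported below the letter 0 count, not the sections
  of all elements of \<open>N\<close> that fix the first level.\<close>

definition section_subgroup :: "(vertex \<Rightarrow> vertex) set \<Rightarrow> (vertex \<Rightarrow> vertex) set" where
  "section_subgroup N = {h \<in> G. pair h id \<in> N}"

text \<open>By self-replication, conjugation by \<open>g\<close> lifts to conjugation by some
  \<open>pair g h\<close> in the group, which leaves the second coordinate of
  \<open>pair x id\<close> trivial.\<close>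

lemma normal_section_subgroup:
  assumes "N \<lhd> sunic_group f"
  shows "section_subgroup N \<lhd> sunic_group f"
proof (rule normalI)
  note N = normalD[OF assms]
  show "section_subgroup N \<subseteq> G"
    by (auto simp: section_subgroup_def)
  show "id \<in> section_subgroup N"
    unfolding section_subgroup_def using N(2) G.one_closed by (simp only: mem_Collect_eq pair_id)
  show "x \<circ> y \<in> section_subgroup N" if "x \<in> section_subgroup N" "y \<in> section_subgroup N" for x y
    using that N(3)[of "pair x id" "pair y id"] G.m_closed
    by (simp add: section_subgroup_def pair_comp)
  show "inv_G x \<in> section_subgroup N" if x: "x \<in> section_subgroup N" for x
  proof -
    have "inv_G x \<circ> x = id"
      using x by (auto simp: section_subgroup_def)
    then have "pair (inv_G x) id \<circ> pair x id = id"
      by (simp only: pair_comp comp_id pair_id)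
    then have "inv_G (pair x id) = pair (inv_G x) id"
      using x N(1) by (intro inv_G_eqI) (auto simp: section_subgroup_def)
    then show ?thesis
      using x N(4)[of "pair x id"] by (simp add: section_subgroup_def)
  qed
  show "g \<circ> x \<circ> inv_G g \<in> section_subgroup N" if g: "g \<in> G" and x: "x \<in> section_subgroup N" for g x
  proof -
    obtain h where h: "pair g h \<in> G"
      using self_replicating g by blast
    have x': "x \<in> G" "pair x id \<in> N"
      using x by (auto simp: section_subgroup_def)
    have "pair g h \<circ> pair x id = pair (g \<circ> x \<circ> inv_G g) id \<circ> pair g h"
      by (simp only: pair_comp comp_assoc G.l_inv[OF g] comp_id id_comp)
    then have "pair g h \<circ> pair x id \<circ> inv_G (pair g h)
        = pair (g \<circ> x \<circ> inv_G g) id \<circ> pair g h \<circ> inv_G (pair g h)"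
      by (rule arg_cong)
    also have "\<dots> = pair (g \<circ> x \<circ> inv_G g) id \<circ> (pair g h \<circ> inv_G (pair g h))"
      by (rule comp_assoc)
    finally have "pair (g \<circ> x \<circ> inv_G g) id \<in> N"
      using N(5)[OF h x'(2)] by (simp only: G.r_inv[OF h] comp_id)
    moreover have "g \<circ> x \<circ> inv_G g \<in> G"
      using g x' by (intro G.m_closed G.inv_closed)
    ultimately show ?thesis
      by (simp add: section_subgroup_def)
  qed
qed

lemma pair_id_left_iff:
  assumes "N \<lhd> sunic_group f"
  shows "pair id h \<in> N \<longleftrightarrow> pair h id \<in> N"
  using normal_conj_swap[OF assms, of "pair id h"] normal_conj_swap[OF assms, of "pair h id"]
  unfolding swap_pair_swap by blast

text \<open>The automorphism supported on the subtree at \<open>v\<close> and acting there like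
  \<open>h\<close>. Membership of \<open>delta v h\<close> in \<open>G\<close> does not follow from
  that of \<open>h\<close>.\<close>

fun delta :: "vertex \<Rightarrow> (vertex \<Rightarrow> vertex) \<Rightarrow> vertex \<Rightarrow> vertex" where
  "delta [] h = h"
| "delta (False # v) h = pair (delta v h) id"
| "delta (True # v) h = pair id (delta v h)"

lemma delta_off_subtree: "take (length v) w \<noteq> v \<Longrightarrow> delta v h w = w"
proof (induction v arbitrary: w)
  case (Cons e v)
  then show ?case
    by (cases w; cases e; cases "hd w") auto
qed simp

lemma delta_on_subtree: "delta v h (v @ w) = v @ h w"
proof (induction v)
  case (Cons e v)
  then show ?case by (cases e) auto
qed simp

lemma take_delta: "take (length v) (delta v h w) = take (length v) w"
proof (cases "take (length v) w = v")
  case True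
  then have "w = v @ drop (length v) w"
    by (metis append_take_drop_id)
  then have "delta v h w = v @ h (drop (length v) w)"
    using delta_on_subtree by metis
  with True show ?thesis by simp
qed (simp add: delta_off_subtree)

lemma delta_comp: "delta v g \<circ> delta v h = delta v (g \<circ> h)"
proof (induction v)
  case (Cons e v)
  then show ?case
    by (cases e) (simp_all only: delta.simps pair_comp comp_id)
qed (simp only: delta.simps)

lemma delta_id: "delta v id = id"
proof (induction v)
  case (Cons e v)
  then show ?case
    by (cases e) (simp_all only: delta.simps pair_id)
qed (simp only: delta.simps)

end

section \<open>Orders of products of \<open>a\<close> with elements of \<open>B\<close>\<close>

lemma act_B_commute:
  assumes "x \<in> carrier (sunic_B f)" "y \<in> carrier (sunic_B f)"
  shows "act_B f x (act_B f y w) = act_B f y (act_B f x w)"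
proof -
  have "x \<otimes>\<^bsub>sunic_B f\<^esub> y = y \<otimes>\<^bsub>sunic_B f\<^esub> x"
    by (simp add: sunic_B_def add.commute del: add_bit_eq_xor)
  then show ?thesis
    using act_B_add[OF assms] act_B_add[OF assms(2,1)] by (metis comp_apply)
qed

lemma double_act_B_swap:
  "(act_B f x \<circ> swap_first) \<circ> (act_B f x \<circ> swap_first)
    = pair (act_A (omega f x) \<circ> act_B f (rho f x)) (act_B f (rho f x) \<circ> act_A (omega f x))"
proof -
  have "(act_B f x \<circ> swap_first) \<circ> (act_B f x \<circ> swap_first)
      = act_B f x \<circ> (swap_first \<circ> act_B f x \<circ> swap_first)"
    by (simp only: comp_assoc)
  then show ?thesis
    unfolding act_B_eq_pair[of f x] swap_pair_swap pair_comp .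
qed

text \<open>With \<open>omega f x\<close> vanishing, both sections of the square are the action of
  \<open>rho f x\<close>, which squares to the identity.\<close>

lemma act_B_swap_funpow_4:
  assumes "omega f x = 0"
  shows "(act_B f x \<circ> swap_first) ^^ 4 = id"
proof -
  have "(act_B f x \<circ> swap_first) ^^ 4 = (act_B f x \<circ> swap_first) ^^ (2 * (2 * 1))"
    by simp
  also have "\<dots> = id"
    unfolding funpow_double double_act_B_swap assms act_A_0 id_comp comp_id pair_comp
      act_B_comp_act_B pair_id by simp
  finally show ?thesis .
qed

text \<open>If \<open>omega f x\<close> is 1, the sections of the square are the two products of
  \<open>a\<close> and the action of \<open>rho f x\<close>, which are conjugate. Infinite order
  would thus pass from \<open>x\<close> to \<open>rho f x\<close>, until a vanishing bit makes the
  fourth power trivial.\<close>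

lemma finite_order_act_B_swap:
  "omega f ((rho f ^^ j) x) = 0 \<Longrightarrow> \<not> infinite_order (act_B f x \<circ> swap_first)"
proof (induction j arbitrary: x)
  case 0
  then show ?case
    by (intro not_infinite_orderI[OF _ act_B_swap_funpow_4]) simp_all
next
  case (Suc j)
  show ?case
  proof (cases "omega f x = 0")
    case True
    then show ?thesis
      by (intro not_infinite_orderI[OF _ act_B_swap_funpow_4]) simp_all
  next
    case False
    then have "omega f x = 1" by simp
    note double = double_act_B_swap[of f x, unfolded this act_A_1]
    have "omega f ((rho f ^^ j) (rho f x)) = 0"
      using Suc.prems by (simp add: funpow_swap1)
    then have fin: "\<not> infinite_order (act_B f (rho f x) \<circ> swap_first)"
      by (rule Suc.IH)
    have "surj swap_first"
      using swap_swap by (rule surjI)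
    then have "\<not> infinite_order (swap_first \<circ> act_B f (rho f x))"
      using fin infinite_order_comp_swap by blast
    with fin show ?thesis
      using infinite_order_double[of "act_B f x \<circ> swap_first", unfolded double]
        infinite_order_pair by blast
  qed
qed

context sunic
begin

section \<open>Self-similarity and sections at deep vertices\<close>

lemma inv_comp: "g \<in> G \<Longrightarrow> h \<in> G \<Longrightarrow> inv_G (g \<circ> h) = inv_G h \<circ> inv_G g"
  by (rule inv_G_eqI) (auto simp: G.m_closed fun_eq_iff)

lemma act_A_in_G: "act_A c \<in> G"
  using G.one_closed gens_in_G(1) by (simp add: act_A_def id_def[symmetric])

text \<open>Self-similarity: the sections of the generators lie in \<open>G\<close>, and left
  multiplication by a generator multiplies the sections by such elements.\<close>

lemma ex_sections:
  assumes "g \<in> G"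
  shows "\<exists>h k. h \<in> G \<and> k \<in> G \<and> (g = pair h k \<or> g = swap_first \<circ> pair h k)"
  using assms
proof (induction rule: sunic_induct)
  case id
  show ?case using G.one_closed pair_id by metis
next
  case (swap g)
  moreover have "swap_first \<circ> (swap_first \<circ> h) = h" for h :: "vertex \<Rightarrow> vertex"
    by auto
  ultimately show ?case by metis
next
  case (act_B x g)
  then obtain h k where hk: "h \<in> G" "k \<in> G" "g = pair h k \<or> g = swap_first \<circ> pair h k"
    by blast
  let ?x = "act_B f (rho f x)" and ?a = "act_A (omega f x)"
  have in_G: "?x \<circ> l \<in> G" "?a \<circ> l \<in> G" if "l \<in> G" for l
    using that gens_in_G(2)[OF rho_closed] act_A_in_G by (simp_all only: G.m_closed)
  have "act_B f x \<circ> pair h k = pair (?a \<circ> h) (?x \<circ> k)"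
    unfolding act_B_eq_pair[of f x] pair_comp ..
  moreover have "act_B f x \<circ> (swap_first \<circ> pair h k)
      = swap_first \<circ> (swap_first \<circ> act_B f x \<circ> swap_first \<circ> pair h k)"
    by auto
  then have "act_B f x \<circ> (swap_first \<circ> pair h k) = swap_first \<circ> pair (?x \<circ> h) (?a \<circ> k)"
    unfolding act_B_eq_pair[of f x] swap_pair_swap pair_comp .
  ultimately show ?case
    using in_G hk by metis
qed

lemma section_in_G:
  assumes "pair h k \<in> G"
  shows "h \<in> G"
proof -
  obtain h' k' where "h' \<in> G" "pair h k = pair h' k' \<or> pair h k = swap_first \<circ> pair h' k'"
    using ex_sections[OF assms] by blast
  moreover have "pair h k [True] \<noteq> (swap_first \<circ> pair h' k') [True]"
    by simp
  ultimately show ?thesis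
    by (metis pair_eq_iff)
qed

definition deep_section_subgroup :: "vertex \<Rightarrow> (vertex \<Rightarrow> vertex) set \<Rightarrow> (vertex \<Rightarrow> vertex) set" where
  "deep_section_subgroup v N = {h \<in> G. delta v h \<in> N}"

lemma deep_section_subgroup_Nil: "N \<lhd> sunic_group f \<Longrightarrow> deep_section_subgroup [] N = N"
  using normalD(1)[of N] by (auto simp: deep_section_subgroup_def)

text \<open>Conjugation by \<open>a\<close> makes the two letters interchangeable, so each letter of
  \<open>v\<close> costs one \<open>section_subgroup\<close>. Self-similarity puts the intermediate
  \<open>delta v h\<close> into \<open>G\<close>.\<close>

lemma deep_section_subgroup_Cons:
  assumes "N \<lhd> sunic_group f"
  shows "deep_section_subgroup (x # v) N = deep_section_subgroup v (section_subgroup N)"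
proof -
  have "delta (x # v) h \<in> N \<longleftrightarrow> pair (delta v h) id \<in> N" for h
    using pair_id_left_iff[OF assms] by (cases x) auto
  moreover have "pair (delta v h) id \<in> N \<Longrightarrow> delta v h \<in> G" for h
    using normalD(1)[OF assms] section_in_G by blast
  ultimately show ?thesis
    by (auto simp: deep_section_subgroup_def section_subgroup_def)
qed

lemma normal_deep_section_subgroup:
  "N \<lhd> sunic_group f \<Longrightarrow> deep_section_subgroup v N \<lhd> sunic_group f"
  by (induction v arbitrary: N)
    (simp_all add: deep_section_subgroup_Nil deep_section_subgroup_Cons normal_section_subgroup)

lemma normal_Inter:
  assumes "\<N> \<noteq> {}" "\<And>N. N \<in> \<N> \<Longrightarrow> N \<lhd> sunic_group f"
  shows "\<Inter>\<N> \<lhd> sunic_group f"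
proof (rule normalI)
  show "\<Inter>\<N> \<subseteq> G"
    using assms normalD(1) by blast
qed (use assms normalD(2-5) in blast)+

text \<open>The double commutator trick: \<open>g\<close> moves the support of \<open>h\<close> away from the subtree at \<open>v\<close>,
  so the commutator of \<open>g\<close> with the inverse of \<open>h\<close> acts on that subtree like \<open>h\<close>.\<close>

lemma double_commutator:
  assumes N: "N \<lhd> sunic_group f" and "g \<in> N" "g v \<noteq> v"
    and h: "h \<in> G" "delta v h \<in> G" and k: "k \<in> G" "delta v k \<in> G"
  shows "delta v (h \<circ> k \<circ> inv_G h \<circ> inv_G k) \<in> N"
proof -
  note gG = normalD(1)[OF N \<open>g \<in> N\<close>]
  have inv_delta: "inv_G (delta v l) = delta v (inv_G l)" if "l \<in> G" "delta v l \<in> G" for l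
  proof (rule inv_G_eqI[OF that(2)])
    show "delta v (inv_G l) \<circ> delta v l = id"
      unfolding delta_comp G.l_inv[OF that(1)] by (rule delta_id)
  qed
  let ?X = "delta v h" and ?Y = "delta v k"
  let ?Xi = "inv_G ?X" and ?gi = "inv_G g" and ?Yi = "inv_G ?Y"
  let ?Z = "g \<circ> ?Xi \<circ> ?gi" and ?n = "length v"
  let ?Zi = "g \<circ> ?X \<circ> ?gi"
  have take_Z: "take ?n (?Z w) = take ?n w" for w
  proof -
    have "take ?n (?Z w) = g (take ?n (?Xi (?gi w)))"
      using apply_take[OF gG] by simp
    also have "\<dots> = take ?n w"
      using apply_take[OF gG] gG by (simp add: inv_delta[OF h] take_delta)
    finally show ?thesis .
  qed
  have off_Z: "?Z w = w" if "take ?n w = v" for w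
  proof -
    have "take ?n (?gi w) \<noteq> v"
      using \<open>g v \<noteq> v\<close> that apply_take[OF gG, of ?n "?gi w"] gG by auto
    then show ?thesis
      using gG by (simp add: inv_delta[OF h] delta_off_subtree)
  qed
  have comm: "?Z (delta v l w) = delta v l (?Z w)" for l w
  proof (cases "take ?n w = v")
    case True
    then show ?thesis
      using off_Z[of w] off_Z[of "delta v l w"] take_delta[of v l w] by simp
  next
    case False
    then show ?thesis
      using delta_off_subtree[of v w l] delta_off_subtree[of v "?Z w" l] take_Z[of w] by simp
  qed
  have ZZi: "?Z (?Zi w) = w" for w
    using gG h by simp
  have "?Xi \<circ> ?gi \<circ> ?X \<in> N"
    using normalD(5)[OF N G.inv_closed[OF h(2)] normalD(4)[OF N \<open>g \<in> N\<close>]]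
    by (simp only: G.inv_inv[OF h(2)])
  then have "g \<circ> (?Xi \<circ> ?gi \<circ> ?X) \<in> N"
    by (rule normalD(3)[OF N \<open>g \<in> N\<close>])
  moreover have "g \<circ> (?Xi \<circ> ?gi \<circ> ?X) = ?Z \<circ> ?X"
    by (simp only: comp_assoc)
  ultimately have ZX: "?Z \<circ> ?X \<in> N" by simp
  have inv_ZX: "inv_G (?Z \<circ> ?X) = ?Xi \<circ> ?Zi"
    using gG h normalD(1)[OF N ZX] by (intro inv_G_eqI) (auto simp: fun_eq_iff)
  have "?Z \<circ> ?X \<circ> ?Y \<circ> inv_G (?Z \<circ> ?X) \<circ> ?Yi \<in> N"
    by (rule normal_commutator[OF N ZX k(2)])
  \<comment> \<open>\<open>?Z\<close> commutes with everything supported below \<open>v\<close>, so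
    it drops out of the commutator of \<open>?Z \<circ> ?X\<close> with \<open>?Y\<close>.\<close>
  moreover have "?Z \<circ> ?X \<circ> ?Y \<circ> inv_G (?Z \<circ> ?X) \<circ> ?Yi = ?X \<circ> ?Y \<circ> ?Xi \<circ> ?Yi"
  proof
    fix w
    have "(?Z \<circ> ?X \<circ> ?Y \<circ> inv_G (?Z \<circ> ?X) \<circ> ?Yi) w = ?Z (?X (?Y (?Xi (?Zi (?Yi w)))))"
      unfolding inv_ZX by simp
    also have "\<dots> = ?X (?Y (?Xi (?Z (?Zi (?Yi w)))))"
      unfolding comm[of h] comm[of k] comm[of "inv_G h", folded inv_delta[OF h]] ..
    also have "\<dots> = (?X \<circ> ?Y \<circ> ?Xi \<circ> ?Yi) w"
      unfolding ZZi by simp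
    finally show "(?Z \<circ> ?X \<circ> ?Y \<circ> inv_G (?Z \<circ> ?X) \<circ> ?Yi) w = (?X \<circ> ?Y \<circ> ?Xi \<circ> ?Yi) w" .
  qed
  ultimately show ?thesis
    by (simp only: inv_delta[OF h] inv_delta[OF k] delta_comp)
qed

text \<open>Modulo \<open>N\<close> the element \<open>c\<close> commutes with \<open>s\<close> and
  squares to the identity, so the fourth power of \<open>c \<circ> s\<close> reduces to that of
  \<open>s\<close>.\<close>

lemma fourth_power_in_normal:
  assumes N: "N \<lhd> sunic_group f" and "c \<in> G" "s \<in> G"
    and "(c \<circ> s) ^^ 4 = id" "c \<circ> c = id" "c \<circ> s \<circ> c \<circ> inv_G s \<in> N"
  shows "s ^^ 4 \<in> N"
proof -
  let ?z = "c \<circ> s \<circ> c \<circ> inv_G s" and ?si = "inv_G s"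
  let ?y = "(s \<circ> s) \<circ> ?z \<circ> inv_G (s \<circ> s)"
  have "s \<circ> s \<in> G"
    using assms by (intro G.m_closed)
  then have "?z \<circ> ?y \<in> N"
    by (intro normalD(3)[OF N assms(6)] normalD(5)[OF N _ assms(6)])
  moreover have "?z \<circ> ?y \<circ> s ^^ 4 = id"
  proof
    fix w
    have "inv_G (s \<circ> s) = ?si \<circ> ?si"
      using assms by (simp only: inv_comp)
    then have "(?z \<circ> ?y \<circ> s ^^ 4) w = ((c \<circ> s) ^^ 4) w"
      using assms(2,3) by (simp add: numeral_eq_Suc)
    then show "(?z \<circ> ?y \<circ> s ^^ 4) w = id w"
      using assms(4) by simp
  qed
  ultimately have "inv_G (s ^^ 4) \<in> N"
    using inv_G_eqI[OF funpow_closed[OF \<open>s \<in> G\<close>]] by metis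
  then show ?thesis
    using normalD(4)[OF N] G.inv_inv[OF funpow_closed[OF \<open>s \<in> G\<close>]] by metis
qed

lemma funpow_mult_normal:
  assumes N: "N \<lhd> sunic_group f" and "n \<in> N" "y \<in> G"
  shows "\<exists>m\<in>N. (y \<circ> n) ^^ j = y ^^ j \<circ> m"
proof (induction j)
  case 0
  show ?case using normalD(2)[OF N] by (intro bexI[of _ id]) simp_all
next
  case (Suc j)
  then obtain m where m: "m \<in> N" "(y \<circ> n) ^^ j = y ^^ j \<circ> m" by blast
  let ?p = "y ^^ j"
  have p: "?p \<in> G" "inv_G ?p \<in> G"
    using funpow_closed[OF \<open>y \<in> G\<close>] by auto
  have "inv_G ?p \<circ> n \<circ> inv_G (inv_G ?p) \<circ> m \<in> N"
    using p m(1) \<open>n \<in> N\<close> by (intro normalD(3,5)[OF N])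
  moreover have "(y \<circ> n) ^^ Suc j = y ^^ Suc j \<circ> (inv_G ?p \<circ> n \<circ> inv_G (inv_G ?p) \<circ> m)"
    unfolding funpow.simps m(2) G.inv_inv[OF p(1)] using p by (auto simp: fun_eq_iff)
  ultimately show ?case by blast
qed

text \<open>Modulo \<open>N\<close> the elements \<open>z\<close> and \<open>u\<close> commute, so \<open>z u z u = 1\<close> makes \<open>u\<^sup>2\<close> the inverse
  of \<open>z\<^sup>2\<close>.\<close>

lemma power_in_normal_if_commutator:
  assumes N: "N \<lhd> sunic_group f" and "z \<in> G" "u \<in> G"
    and zuzu: "z \<circ> u \<circ> z \<circ> u = id" and "z ^^ p = id"
    and comm: "z \<circ> inv_G u \<circ> inv_G z \<circ> u \<in> N"
  shows "u ^^ (2 * p) \<in> N"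
proof -
  let ?y = "inv_G z \<circ> inv_G z" and ?n = "z \<circ> inv_G u \<circ> inv_G z \<circ> u"
  have zi: "inv_G z (u w) = u (z (u (u w)))" for w
  proof -
    have "z (u (z (u (u w)))) = u w"
      using zuzu by (simp add: fun_eq_iff)
    then show ?thesis
      using \<open>z \<in> G\<close> by (metis inv_G_apply(2))
  qed
  have "u \<circ> u = ?y \<circ> ?n"
    using assms(2,3) by (auto simp: fun_eq_iff zi)
  moreover have "?y \<in> G"
    using assms by (intro G.m_closed G.inv_closed)
  ultimately obtain m where m: "m \<in> N" "u ^^ (2 * p) = ?y ^^ p \<circ> m"
    unfolding funpow_double using funpow_mult_normal[OF N comm] by metis
  have "inv_G z ^^ p = inv_G (z ^^ p)"
    using G.nat_pow_inv[OF \<open>z \<in> G\<close>, of p] by (simp only: nat_pow_eq_funpow)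
  then have "inv_G z ^^ p = id"
    using assms(5) by (simp only: G.inv_one)
  then have "inv_G z ^^ (2 * p) = id"
    using funpow_mult_eq_id[of p "inv_G z" 2] by (simp only: mult.commute)
  then show ?thesis
    using m by (simp only: funpow_double id_comp)
qed

end

section \<open>Nontrivial normal subgroups contain a power of the translation\<close>

locale nontorsion_sunic = sunic +
  fixes e :: "nat \<Rightarrow> bit"
  assumes e_in_B: "e \<in> B" and always_swapping: "omega f ((rho f ^^ j) e) = 1"
begin

abbreviation "\<beta> \<equiv> act_B f e"

text \<open>\<open>\<sigma>\<close> below is the inverse of \<open>\<tau>\<close>. Natural powers of
  both stand in for the integer powers of the translation.\<close>

definition "\<tau> = swap_first \<circ> \<beta>"
definition "\<sigma> = \<beta> \<circ> swap_first"

text \<open>All bits of \<open>e\<close> and of \<open>rho f e\<close> equal 1, so both vectors act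
  identically and \<open>\<beta>\<close> is its own section at the letter 1.\<close>

lemma beta_eq_pair: "\<beta> = pair swap_first \<beta>"
proof -
  have "act_B f (rho f e) = \<beta>"
  proof (rule act_B_cong)
    show "omega f ((rho f ^^ j) (rho f e)) = omega f ((rho f ^^ j) e)" for j
      using always_swapping[of "Suc j"] always_swapping[of j] by (simp add: funpow_swap1)
  qed
  moreover have "omega f e = 1"
    using always_swapping[of 0] by simp
  ultimately show ?thesis
    using act_B_eq_pair[of f e] by (simp only: act_A_1)
qed

lemma beta_in_G: "\<beta> \<in> G"
  by (rule gens_in_G(2)[OF e_in_B])

lemma tau_in_G: "\<tau> \<in> G" and sigma_in_G: "\<sigma> \<in> G"
  unfolding \<tau>_def \<sigma>_def using beta_in_G gens_in_G(1) by (auto intro: G.m_closed)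

lemma tau_sigma [simp]: "\<tau> (\<sigma> w) = w" and sigma_tau [simp]: "\<sigma> (\<tau> w) = w"
  by (simp_all add: \<tau>_def \<sigma>_def)

lemma inv_tau: "inv_G \<tau> = \<sigma>" and inv_sigma: "inv_G \<sigma> = \<tau>"
  by (rule inv_G_eqI; auto simp: tau_in_G sigma_in_G)+

lemma swap_tau_swap: "swap_first \<circ> \<tau> \<circ> swap_first = \<sigma>"
  and swap_sigma_swap: "swap_first \<circ> \<sigma> \<circ> swap_first = \<tau>"
  and beta_tau_beta: "\<beta> \<circ> \<tau> \<circ> \<beta> = \<sigma>"
  by (auto simp: \<tau>_def \<sigma>_def)

lemma sigma_pow: "\<sigma> ^^ n = swap_first \<circ> \<tau> ^^ n \<circ> swap_first"
  and sigma_pow': "\<sigma> ^^ n = \<beta> \<circ> \<tau> ^^ n \<circ> \<beta>"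
  using funpow_conj_involution[OF swap_comp_swap, where h = \<tau> and n = n]
    funpow_conj_involution[OF act_B_comp_act_B[of f e], where h = \<tau> and n = n]
  unfolding swap_tau_swap beta_tau_beta by blast+

lemma tau_pow_sigma_pow [simp]: "(\<tau> ^^ n) ((\<sigma> ^^ n) w) = w"
  and sigma_pow_tau_pow [simp]: "(\<sigma> ^^ n) ((\<tau> ^^ n) w) = w"
  by (induction n arbitrary: w) (simp_all add: funpow_swap1)

lemma tau_tau: "\<tau> \<circ> \<tau> = pair \<sigma> \<tau>"
proof -
  have "\<tau> \<circ> \<tau> = (swap_first \<circ> \<beta> \<circ> swap_first) \<circ> \<beta>"
    by (simp only: \<tau>_def comp_assoc)
  also have "\<dots> = (swap_first \<circ> pair swap_first \<beta> \<circ> swap_first) \<circ> pair swap_first \<beta>"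
    by (simp only: beta_eq_pair[symmetric])
  finally show ?thesis
    by (simp only: swap_pair_swap pair_comp \<tau>_def \<sigma>_def)
qed

lemma sigma_sigma: "\<sigma> \<circ> \<sigma> = pair \<tau> \<sigma>"
proof -
  have "\<sigma> \<circ> \<sigma> = swap_first \<circ> (\<tau> \<circ> \<tau>) \<circ> swap_first"
    by (auto simp: \<tau>_def \<sigma>_def)
  then show ?thesis
    by (simp only: tau_tau swap_pair_swap)
qed

text \<open>\<open>\<tau> ^^ (2 * k)\<close> has the sections \<open>\<sigma> ^^ k\<close> and
  \<open>\<tau> ^^ k\<close>. Conjugation by \<open>a\<close> turns \<open>\<tau> ^^ k\<close> into
  \<open>\<sigma> ^^ k\<close> and exchanges the coordinates, so each coordinate is placed in
  \<open>N\<close> separately.\<close>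

lemma tau_pow_in_normal_if_in_section_subgroup:
  assumes N: "N \<lhd> sunic_group f" and "\<tau> ^^ k \<in> section_subgroup N"
  shows "\<tau> ^^ (2 * k) \<in> N"
proof -
  have "\<sigma> ^^ k \<in> section_subgroup N"
    unfolding sigma_pow by (rule normal_conj_swap[OF normal_section_subgroup[OF N] assms(2)])
  then have "pair (\<sigma> ^^ k) id \<in> N"
    by (simp add: section_subgroup_def)
  moreover have "pair id (\<tau> ^^ k) \<in> N"
    using assms(2) pair_id_left_iff[OF N] by (simp add: section_subgroup_def)
  ultimately have "pair (\<sigma> ^^ k) id \<circ> pair id (\<tau> ^^ k) \<in> N"
    by (rule normalD(3)[OF N])
  then show ?thesis
    by (simp only: pair_comp id_comp comp_id funpow_double tau_tau pair_funpow)
qed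

lemma tau_pow_in_normal_if_in_deep_section_subgroup:
  assumes "N \<lhd> sunic_group f" "k > 0" "\<tau> ^^ k \<in> deep_section_subgroup v N"
  shows "\<exists>k>0. \<tau> ^^ k \<in> N"
  using assms
proof (induction v arbitrary: N)
  case Nil
  then show ?case using deep_section_subgroup_Nil by auto
next
  case (Cons x v)
  then obtain k where "k > 0" "\<tau> ^^ k \<in> section_subgroup N"
    using Cons.IH[OF normal_section_subgroup] deep_section_subgroup_Cons by metis
  with tau_pow_in_normal_if_in_section_subgroup[OF \<open>N \<lhd> sunic_group f\<close>] show ?case
    by (intro exI[of _ "2 * k"]) simp
qed

text \<open>Here \<open>B\<close> acts only through the identity and \<open>\<beta>\<close>, so each
  element is an integer power of the translation, possibly times \<open>\<beta>\<close>.\<close>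

lemma tau_pow_in_normal_degree_1:
  assumes N: "N \<lhd> sunic_group f" and "g \<in> N" "g \<noteq> id" and deg: "degree f = 1"
  shows "\<exists>k>0. \<tau> ^^ k \<in> N"
proof -
  have "e 0 = 1"
    using always_swapping[of 0] deg by (simp add: omega_def)
  have B: "act_B f x = id \<or> act_B f x = \<beta>" if "x \<in> B" for x
  proof (cases "x 0 = 0")
    case True
    then have "x i = 0" for i
      using that deg by (cases i) (auto simp: sunic_B_def)
    then have "x = (\<lambda>_. 0)" by auto
    then show ?thesis by simp
  next
    case False
    then have "x i = e i" for i
      using that e_in_B deg \<open>e 0 = 1\<close> by (cases i) (auto simp: sunic_B_def)
    then have "x = e" by auto
    then show ?thesis by simp
  qed
  have "\<exists>k h. (h = id \<or> h = \<beta>) \<and> (g = \<tau> ^^ k \<circ> h \<or> g = \<sigma> ^^ k \<circ> h)" if "g \<in> G" for g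
    using that
  proof (induction rule: sunic_induct)
    case id
    show ?case by (intro exI[of _ 0] exI[of _ id]) simp
  next
    case (swap g)
    then obtain k h where h: "h = id \<or> h = \<beta>" and g: "g = \<tau> ^^ k \<circ> h \<or> g = \<sigma> ^^ k \<circ> h"
      by blast
    obtain h' where h': "h' = id \<or> h' = \<beta>" "h = \<beta> \<circ> h'"
      using h by (metis act_B_comp_act_B comp_id)
    from g show ?case
    proof
      assume "g = \<tau> ^^ k \<circ> h"
      moreover have "swap_first \<circ> (\<tau> ^^ k \<circ> (\<beta> \<circ> h')) = \<tau> \<circ> (\<sigma> ^^ k \<circ> h')"
        by (auto simp: sigma_pow' \<tau>_def)
      \<comment> \<open>Cancelling \<open>\<tau>\<close> against \<open>\<sigma> ^^ k\<close> needs
        \<open>k > 0\<close>; the first alternative covers \<open>k = 0\<close>, where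
        \<open>k - 1\<close> truncates.\<close>
      moreover have "\<tau> \<circ> (\<sigma> ^^ k \<circ> h') = \<tau> ^^ 1 \<circ> h' \<or> \<tau> \<circ> (\<sigma> ^^ k \<circ> h') = \<sigma> ^^ (k - 1) \<circ> h'"
        by (cases k) auto
      ultimately show ?thesis
        using h' by metis
    next
      assume "g = \<sigma> ^^ k \<circ> h"
      moreover have "swap_first \<circ> (\<sigma> ^^ k \<circ> (\<beta> \<circ> h')) = \<tau> ^^ Suc k \<circ> h'"
        by (auto simp: sigma_pow' \<tau>_def)
      ultimately show ?thesis
        using h' by metis
    qed
  next
    case (act_B x g)
    then obtain k h where h: "h = id \<or> h = \<beta>" and g: "g = \<tau> ^^ k \<circ> h \<or> g = \<sigma> ^^ k \<circ> h"
      by blast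
    have h': "\<beta> \<circ> h = id \<or> \<beta> \<circ> h = \<beta>"
      using h by auto
    have "\<beta> \<circ> (\<tau> ^^ k \<circ> h) = \<sigma> ^^ k \<circ> (\<beta> \<circ> h)" "\<beta> \<circ> (\<sigma> ^^ k \<circ> h) = \<tau> ^^ k \<circ> (\<beta> \<circ> h)"
      by (auto simp: sigma_pow')
    then show ?case
      using B[OF act_B.hyps(1)] h h' g by (metis id_comp)
  qed
  then obtain k h where h: "h = id \<or> h = \<beta>" and g: "g = \<tau> ^^ k \<circ> h \<or> g = \<sigma> ^^ k \<circ> h"
    using normalD(1)[OF N \<open>g \<in> N\<close>] by blast
  from h show ?thesis
  proof
    assume "h = id"
    then have "\<tau> ^^ k \<in> N"
    proof -
      have "swap_first \<circ> \<sigma> ^^ k \<circ> swap_first = \<tau> ^^ k"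
        by (auto simp: sigma_pow)
      then show ?thesis
        using g \<open>h = id\<close> \<open>g \<in> N\<close> normal_conj_swap[OF N \<open>g \<in> N\<close>] by (metis comp_id)
    qed
    moreover have "k > 0"
      using g \<open>h = id\<close> \<open>g \<noteq> id\<close> by (cases k) auto
    ultimately show ?thesis by blast
  next
    assume "h = \<beta>"
    have "\<tau> ((\<sigma> ^^ k) w) = (\<sigma> ^^ k) (\<tau> w)" for w
    proof (cases k)
      case (Suc j)
      have "(\<sigma> ^^ Suc j) (\<tau> w) = (\<sigma> ^^ j) w"
        by (simp add: funpow_swap1)
      then show ?thesis using Suc by simp
    qed simp
    moreover have "\<beta> \<circ> \<sigma> = \<tau> \<circ> \<beta>"
      by (auto simp: \<tau>_def \<sigma>_def)
    then have "\<beta> (\<sigma> w) = \<tau> (\<beta> w)" for w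
      by (simp add: fun_eq_iff)
    ultimately have "\<tau> \<circ> (\<tau> ^^ k \<circ> \<beta>) = \<tau> ^^ k \<circ> \<beta> \<circ> \<sigma>"
      "\<tau> \<circ> (\<sigma> ^^ k \<circ> \<beta>) = \<sigma> ^^ k \<circ> \<beta> \<circ> \<sigma>"
      by (auto simp: fun_eq_iff funpow_swap1)
    \<comment> \<open>The reflection \<open>g\<close> conjugates the translation to its inverse, so
      the commutator of \<open>\<tau>\<close> and \<open>g\<close> is conjugate to
      \<open>\<sigma> \<circ> \<sigma>\<close>.\<close>
    then have "\<tau> \<circ> g = g \<circ> \<sigma>"
      using g unfolding \<open>h = \<beta>\<close> by blast
    then have "\<tau> (g w) = g (\<sigma> w)" for w
      by (simp add: fun_eq_iff)
    then have "inv_G g \<circ> (\<tau> \<circ> g \<circ> inv_G \<tau> \<circ> inv_G g) \<circ> inv_G (inv_G g) = \<sigma> \<circ> \<sigma>"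
      using normalD(1)[OF N \<open>g \<in> N\<close>] by (auto simp: fun_eq_iff G.inv_inv inv_tau)
    moreover have "\<tau> \<circ> g \<circ> inv_G \<tau> \<circ> inv_G g \<in> N"
      using tau_in_G \<open>g \<in> N\<close> by (intro normalD(3,5)[OF N] normalD(4)[OF N])
    ultimately have "\<sigma> \<circ> \<sigma> \<in> N"
      using normalD(5)[OF N] G.inv_closed[OF normalD(1)[OF N \<open>g \<in> N\<close>]] by metis
    then have "inv_G (\<sigma> \<circ> \<sigma>) \<in> N"
      by (rule normalD(4)[OF N])
    then have "\<tau> ^^ 2 \<in> N"
      by (simp only: inv_comp sigma_in_G inv_sigma numeral_2_eq_2 funpow.simps comp_id)
    then show ?thesis
      by (intro exI[of _ 2]) simp
  qed
qed

text \<open>\<open>rho f\<close> permutes the finite set \<open>B\<close>, so the orbit of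
  \<open>d\<close> is purely periodic and returns to \<open>d\<close>, where the bit is 0.\<close>

lemma ex_omega_rho_pow_0:
  assumes "d \<in> B" "omega f d = 0"
  shows "\<exists>j. omega f ((rho f ^^ j) (rho f d)) = 0"
proof -
  have pow_B: "(rho f ^^ i) d \<in> B" for i
    using assms rho_closed by (cases i) auto
  have "\<not> inj (\<lambda>i. (rho f ^^ i) d)"
    using finite_subset[OF _ finite_sunic_B, of "range (\<lambda>i. (rho f ^^ i) d)"] pow_B
    using finite_imageD infinite_UNIV_nat by blast
  then obtain i j where "i \<noteq> j" and eq: "(rho f ^^ i) d = (rho f ^^ j) d"
    unfolding inj_def by blast
  have "\<exists>i k. k > 0 \<and> (rho f ^^ i) d = (rho f ^^ (i + k)) d"
  proof (cases "i < j")
    case True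
    then show ?thesis using eq by (intro exI[of _ i] exI[of _ "j - i"]) simp
  next
    case False
    then show ?thesis
      using eq \<open>i \<noteq> j\<close> by (intro exI[of _ j] exI[of _ "i - j"]) simp
  qed
  then obtain i k where "k > 0" "(rho f ^^ i) d = (rho f ^^ (i + k)) d"
    by blast
  then have "d = (rho f ^^ k) d"
  proof (induction i)
    case (Suc i)
    then have "(rho f ^^ i) d = (rho f ^^ (i + k)) d"
      using rho_bij[OF poly] pow_B unfolding bij_betw_def inj_on_def by simp
    with Suc show ?case by blast
  qed simp
  then have "omega f ((rho f ^^ (k - 1)) (rho f d)) = 0"
    using \<open>k > 0\<close> assms by (cases k) (simp_all add: funpow_swap1)
  then show ?thesis by blast
qed

end

section \<open>The branch structure in degree at least two\<close>

locale branch_sunic = nontorsion_sunic +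
  assumes degree_ge_2: "degree f \<ge> 2"
begin

text \<open>\<open>c\<close> and \<open>d\<close> are the last two basis vectors. Since
  \<open>omega f d\<close> is 0 and \<open>rho f d\<close> is \<open>c\<close>, the vector
  \<open>d\<close> acts as \<open>pair id \<gamma>\<close>.\<close>

abbreviation "c \<equiv> sunic_b (degree f - 1)"
abbreviation "d \<equiv> sunic_b (degree f - 2)"
abbreviation "\<gamma> \<equiv> act_B f c"

lemma c_d_in_B: "c \<in> B" "d \<in> B"
  using degree_ge_2 by (auto simp: sunic_B_def sunic_b_def)

lemma omega_c: "omega f c = 1" and omega_d: "omega f d = 0" and rho_d: "rho f d = c"
proof -
  have "degree f - 2 + 1 = degree f - 1"
    using degree_ge_2 by simp
  then show "omega f c = 1" "omega f d = 0" "rho f d = c"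
    using degree_ge_2 by (auto simp: omega_sunic_b rho_sunic_b rho_basis_def)
qed

lemma gamma_eq_pair: "\<gamma> = pair swap_first (act_B f (rho f c))"
  using act_B_eq_pair[of f c] by (simp only: omega_c act_A_1)

lemma gamma_in_G: "\<gamma> \<in> G"
  by (rule gens_in_G(2)[OF c_d_in_B(1)])

definition K :: "(vertex \<Rightarrow> vertex) set" where
  "K = \<Inter>{N. N \<lhd> sunic_group f \<and> swap_first \<circ> \<gamma> \<circ> swap_first \<circ> \<gamma> \<in> N}"

lemma normal_K: "K \<lhd> sunic_group f"
proof -
  have "swap_first \<circ> \<gamma> \<circ> swap_first \<circ> \<gamma> \<in> G"
    using gens_in_G(1) gamma_in_G by (intro G.m_closed)
  moreover have "G \<lhd> sunic_group f"
    by (rule normalI) (auto intro: G.m_closed G.one_closed)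
  ultimately show ?thesis
    unfolding K_def by (intro normal_Inter) auto
qed

lemma K_subset:
  "N \<lhd> sunic_group f \<Longrightarrow> swap_first \<circ> \<gamma> \<circ> swap_first \<circ> \<gamma> \<in> N \<Longrightarrow> K \<subseteq> N"
  by (auto simp: K_def)

text \<open>\<open>\<gamma>\<close> commutes with \<open>B\<close> and, modulo \<open>K\<close>,
  with \<open>a\<close>; hence it is central modulo \<open>K\<close>.\<close>

lemma gamma_commutator_in_K: "g \<in> G \<Longrightarrow> \<gamma> \<circ> g \<circ> \<gamma> \<circ> inv_G g \<in> K"
proof (induction rule: sunic_induct)
  case id
  have "\<gamma> \<circ> id \<circ> \<gamma> \<circ> inv_G id = id"
    by (simp only: G.inv_one comp_id act_B_comp_act_B)
  then show ?case
    using normalD(2)[OF normal_K] by (simp only:)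
next
  case (swap g)
  have base: "swap_first \<circ> \<gamma> \<circ> swap_first \<circ> \<gamma> \<in> K"
    by (auto simp: K_def)
  have "inv_G (swap_first \<circ> g) = inv_G g \<circ> swap_first"
    using swap gens_in_G(1) by (simp only: inv_comp inv_swap)
  then have "\<gamma> \<circ> (swap_first \<circ> g) \<circ> \<gamma> \<circ> inv_G (swap_first \<circ> g)
      = (swap_first \<circ> (swap_first \<circ> \<gamma> \<circ> swap_first \<circ> \<gamma>) \<circ> swap_first)
        \<circ> (swap_first \<circ> (\<gamma> \<circ> g \<circ> \<gamma> \<circ> inv_G g) \<circ> swap_first)"
    by (auto simp: fun_eq_iff)
  then show ?case
    using normalD(3)[OF normal_K normal_conj_swap[OF normal_K base] normal_conj_swap[OF normal_K swap.IH]]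
    by (simp only:)
next
  case (act_B x g)
  let ?x = "act_B f x"
  have "inv_G (?x \<circ> g) = inv_G g \<circ> ?x"
    using act_B gens_in_G(2) by (simp only: inv_comp inv_act_B)
  moreover have "\<gamma> (?x w) = ?x (\<gamma> w)" for w
    using act_B_commute[OF c_d_in_B(1) act_B.hyps(1)] .
  ultimately have "\<gamma> \<circ> (?x \<circ> g) \<circ> \<gamma> \<circ> inv_G (?x \<circ> g)
      = ?x \<circ> (\<gamma> \<circ> g \<circ> \<gamma> \<circ> inv_G g) \<circ> inv_G ?x"
    using act_B.hyps(1) by (auto simp: fun_eq_iff inv_act_B)
  then show ?case
    using normalD(5)[OF normal_K gens_in_G(2)[OF act_B.hyps(1)] act_B.IH] by (simp only:)
qed

text \<open>\<open>G\<close> is regular branch over \<open>K\<close>: the section \<open>\<rho> d = c\<close> of \<open>d\<close> can be placed below either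
  letter, and commuting it with \<open>c\<close> produces the generator of \<open>K\<close> below that letter.\<close>

lemma pair_K_in_K:
  assumes "k \<in> K"
  shows "pair k id \<in> K"
proof -
  let ?z = "swap_first \<circ> \<gamma> \<circ> swap_first \<circ> \<gamma>"
  let ?r = "act_B f (rho f c)"
  let ?g = "swap_first \<circ> act_B f d \<circ> swap_first"
  have g_in_G: "?g \<in> G"
    using gens_in_G c_d_in_B by (intro G.m_closed)
  have "act_B f d = pair id \<gamma>"
    using act_B_eq_pair[of f d] by (simp only: omega_d act_A_0 rho_d)
  then have g: "?g = pair \<gamma> id"
    by (simp only: swap_pair_swap)
  have "pair \<gamma> id \<circ> pair \<gamma> id = id"
    by (simp only: pair_comp act_B_comp_act_B comp_id pair_id)
  then have "inv_G (pair \<gamma> id) = pair \<gamma> id"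
    using inv_G_eqI g_in_G unfolding g by blast
  moreover have "\<gamma> \<circ> pair \<gamma> id \<circ> \<gamma> \<circ> pair \<gamma> id = pair ?z id"
  proof -
    have "\<gamma> \<circ> pair \<gamma> id \<circ> \<gamma> \<circ> pair \<gamma> id
        = pair swap_first ?r \<circ> pair \<gamma> id \<circ> pair swap_first ?r \<circ> pair \<gamma> id"
      by (simp only: gamma_eq_pair[symmetric])
    then show ?thesis
      by (simp only: pair_comp comp_id act_B_comp_act_B)
  qed
  ultimately have "pair ?z id \<in> K"
    using gamma_commutator_in_K[OF g_in_G] unfolding g by (simp only:)
  moreover have "?z \<in> G"
    using gens_in_G(1) gamma_in_G by (intro G.m_closed)
  ultimately have "?z \<in> section_subgroup K"
    by (simp only: section_subgroup_def mem_Collect_eq)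
  then have "k \<in> section_subgroup K"
    using K_subset[OF normal_section_subgroup[OF normal_K]] assms by blast
  then show ?thesis
    by (simp only: section_subgroup_def mem_Collect_eq)
qed

lemma delta_K_in_K: "k \<in> K \<Longrightarrow> delta v k \<in> K"
proof (induction v)
  case (Cons x v)
  then show ?case
    using pair_K_in_K pair_id_left_iff[OF normal_K] by (cases x) (simp_all only: delta.simps)
qed (simp only: delta.simps)

text \<open>For a vertex \<open>v\<close> moved by \<open>g\<close>, the double commutator puts all
  commutators of elements of \<open>K\<close> into \<open>M\<close>. One of them is supported below
  a single letter and forces a power of the translation into the section subgroup of
  \<open>M\<close>, from where it is lifted back to \<open>N\<close>.\<close>

lemma tau_pow_in_normal_degree_ge_2:
  assumes N: "N \<lhd> sunic_group f" and "g \<in> N" "g \<noteq> id"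
  shows "\<exists>k>0. \<tau> ^^ k \<in> N"
proof -
  obtain v where v: "g v \<noteq> v"
    using \<open>g \<noteq> id\<close> by (auto simp: fun_eq_iff)
  define M where "M = deep_section_subgroup v N"
  have M: "M \<lhd> sunic_group f"
    unfolding M_def by (rule normal_deep_section_subgroup[OF N])
  note K_in_G = normalD(1)[OF normal_K]
  have K_comm: "h \<circ> k \<circ> inv_G h \<circ> inv_G k \<in> M" if "h \<in> K" "k \<in> K" for h k
  proof -
    have "h \<circ> k \<circ> inv_G h \<circ> inv_G k \<in> G"
      using K_in_G[OF that(1)] K_in_G[OF that(2)] by (intro G.m_closed G.inv_closed)
    then show ?thesis
      using double_commutator[OF N \<open>g \<in> N\<close> v] K_in_G delta_K_in_K that
      by (simp add: M_def deep_section_subgroup_def)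
  qed

  \<comment> \<open>Both bits are 1, so the product of \<open>\<gamma>\<close> and
    \<open>\<beta>\<close> has bit 0. Times \<open>a\<close> it is
    \<open>\<gamma> \<circ> \<sigma>\<close>, whose fourth power is therefore trivial.\<close>
  have "omega f (c \<otimes>\<^bsub>sunic_B f\<^esub> e) = 0"
    using omega_c always_swapping[of 0] by (simp add: sunic_B_def omega_def)
  then have "(act_B f (c \<otimes>\<^bsub>sunic_B f\<^esub> e) \<circ> swap_first) ^^ 4 = id"
    by (rule act_B_swap_funpow_4)
  then have gamma_sigma_4: "(\<gamma> \<circ> \<sigma>) ^^ 4 = id"
    unfolding act_B_add[OF c_d_in_B(1) e_in_B, symmetric] \<sigma>_def comp_assoc .
  define z where "z = \<gamma> \<circ> \<sigma> \<circ> \<gamma> \<circ> inv_G \<sigma>"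
  have z: "z \<in> K"
    unfolding z_def by (rule gamma_commutator_in_K[OF sigma_in_G])
  have sigma_4: "\<sigma> ^^ 4 \<in> K"
    using fourth_power_in_normal[OF normal_K gamma_in_G sigma_in_G gamma_sigma_4 act_B_comp_act_B] z
    unfolding z_def .

  \<comment> \<open>\<open>z\<close> is conjugate to the square of
    \<open>\<gamma> \<circ> swap_first\<close>, which has finite order because some later bit of
    \<open>c\<close> vanishes.\<close>
  obtain p where "p > 0" and p: "z ^^ p = id"
  proof -
    have "\<not> infinite_order (\<gamma> \<circ> swap_first)"
      using ex_omega_rho_pow_0[OF c_d_in_B(2) omega_d] finite_order_act_B_swap unfolding rho_d by blast
    moreover have "z = \<beta> \<circ> ((\<gamma> \<circ> swap_first) \<circ> (\<gamma> \<circ> swap_first)) \<circ> \<beta>"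
      using act_B_commute[OF c_d_in_B(1) e_in_B]
      unfolding z_def inv_sigma unfolding \<sigma>_def \<tau>_def by (auto simp: fun_eq_iff)
    ultimately have "\<not> infinite_order z"
      using infinite_order_if_double infinite_order_conj_involution[OF act_B_comp_act_B] by metis
    then show ?thesis
      using that by (auto simp: infinite_order_def)
  qed

  let ?u = "\<sigma> \<circ> \<sigma>"
  have u: "inv_G ?u = \<tau> \<circ> \<tau>" "?u \<in> G"
    using sigma_in_G by (simp_all only: inv_comp inv_sigma G.m_closed)
  have zG: "z \<in> G"
    by (rule K_in_G[OF z])
  \<comment> \<open>The commutator of the elements \<open>pair z id\<close> and
    \<open>\<sigma> ^^ 4\<close> of \<open>K\<close> lives below the letter 0 only.\<close>
  have "z \<circ> inv_G ?u \<circ> inv_G z \<circ> ?u \<in> section_subgroup M"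
  proof -
    have pow: "\<sigma> ^^ 4 = pair (\<tau> \<circ> \<tau>) (\<sigma> \<circ> \<sigma>)"
    proof -
      have "\<sigma> ^^ 4 = \<sigma> ^^ (2 * (2 * 1))" by simp
      also have "\<dots> = (\<sigma> \<circ> \<sigma>) \<circ> (\<sigma> \<circ> \<sigma>)"
        unfolding funpow_double by simp
      finally show ?thesis
        by (simp only: sigma_sigma pair_comp)
    qed
    have "pair (inv_G z) id \<circ> pair z id = id"
      by (simp only: pair_comp G.l_inv[OF zG] comp_id pair_id)
    then have inv_pz: "inv_G (pair z id) = pair (inv_G z) id"
      using K_in_G[OF pair_K_in_K[OF z]] by (intro inv_G_eqI)
    have cancel: "(\<sigma> \<circ> \<sigma>) \<circ> (\<tau> \<circ> \<tau>) = id" "(\<tau> \<circ> \<tau>) \<circ> (\<sigma> \<circ> \<sigma>) = id"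
      by (auto simp: fun_eq_iff)
    have "pair (\<sigma> \<circ> \<sigma>) (\<tau> \<circ> \<tau>) \<circ> pair (\<tau> \<circ> \<tau>) (\<sigma> \<circ> \<sigma>) = id"
      unfolding pair_comp cancel by (rule pair_id)
    then have inv_pow: "inv_G (pair (\<tau> \<circ> \<tau>) (\<sigma> \<circ> \<sigma>)) = pair (\<sigma> \<circ> \<sigma>) (\<tau> \<circ> \<tau>)"
      using K_in_G[OF sigma_4] unfolding pow by (intro inv_G_eqI)
    have "pair z id \<circ> \<sigma> ^^ 4 \<circ> inv_G (pair z id) \<circ> inv_G (\<sigma> ^^ 4) \<in> M"
      by (rule K_comm[OF pair_K_in_K[OF z] sigma_4])
    then have "pair (z \<circ> (\<tau> \<circ> \<tau>) \<circ> inv_G z \<circ> (\<sigma> \<circ> \<sigma>)) id \<in> M"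
      by (simp only: pow inv_pz inv_pow pair_comp id_comp comp_id cancel)
    moreover have "z \<circ> (\<tau> \<circ> \<tau>) \<circ> inv_G z \<circ> (\<sigma> \<circ> \<sigma>) \<in> G"
      using zG tau_in_G sigma_in_G by (intro G.m_closed G.inv_closed)
    ultimately show ?thesis
      by (simp only: u section_subgroup_def mem_Collect_eq)
  qed
  \<comment> \<open>Written out, \<open>z \<circ> ?u\<close> collapses to the square of
    \<open>\<gamma> \<circ> \<sigma>\<close>, so its own square is trivial.\<close>
  moreover have "z \<circ> ?u \<circ> z \<circ> ?u = id"
  proof -
    have "z \<circ> ?u = (\<gamma> \<circ> \<sigma>) ^^ 2"
      unfolding z_def inv_sigma by (simp add: numeral_2_eq_2 fun_eq_iff)
    then have "(z \<circ> ?u) \<circ> (z \<circ> ?u) = (\<gamma> \<circ> \<sigma>) ^^ (2 + 2)"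
      by (simp only: funpow_add)
    then show ?thesis
      using gamma_sigma_4 by (simp add: comp_assoc)
  qed
  ultimately have "?u ^^ (2 * p) \<in> section_subgroup M"
    using power_in_normal_if_commutator[OF normal_section_subgroup[OF M] zG u(2) _ p] by blast
  then have "\<sigma> ^^ (2 * (2 * p)) \<in> section_subgroup M"
    by (simp only: funpow_double[of "2 * p" \<sigma>])
  moreover have "\<tau> ^^ (2 * (2 * p)) = swap_first \<circ> \<sigma> ^^ (2 * (2 * p)) \<circ> swap_first"
    by (auto simp: sigma_pow)
  ultimately have "\<tau> ^^ (2 * (2 * p)) \<in> section_subgroup M"
    using normal_conj_swap[OF normal_section_subgroup[OF M]] by simp
  then have "\<tau> ^^ (2 * (2 * (2 * p))) \<in> M"
    by (rule tau_pow_in_normal_if_in_section_subgroup[OF M])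
  then show ?thesis
    using tau_pow_in_normal_if_in_deep_section_subgroup[OF N, of "2 * (2 * (2 * p))" v] \<open>p > 0\<close>
    unfolding M_def by simp
qed

end

context nontorsion_sunic
begin

lemma tau_pow_in_normal:
  assumes "N \<lhd> sunic_group f" and "g \<in> N" "g \<noteq> id"
  shows "\<exists>k>0. \<tau> ^^ k \<in> N"
proof (cases "degree f = 1")
  case True
  then show ?thesis using tau_pow_in_normal_degree_1 assms by blast
next
  case False
  then interpret branch_sunic f e
    using poly by unfold_locales (auto simp: sunic_poly_def)
  show ?thesis
    using tau_pow_in_normal_degree_ge_2 assms by blast
qed

end

section \<open>The Frattini subgroup is normal\<close>

context group
begin

lemma inv_mult_cancel_left: "x \<in> carrier G \<Longrightarrow> y \<in> carrier G \<Longrightarrow> inv x \<otimes> (x \<otimes> y) = y"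
  by (simp add: m_assoc[symmetric])

lemma conj_subgroup_preimage:
  assumes "subgroup H G" "g \<in> carrier G"
  shows "subgroup {y \<in> carrier G. g \<otimes> y \<otimes> inv g \<in> H} G" (is "subgroup ?H G")
proof (rule subgroupI)
  have "g \<otimes> \<one> \<otimes> inv g = \<one>"
    using assms(2) by simp
  then show "?H \<noteq> {}"
    using subgroup.one_closed[OF assms(1)] by force
  show "inv y \<in> ?H" if "y \<in> ?H" for y
  proof -
    have "g \<otimes> inv y \<otimes> inv g = inv (g \<otimes> y \<otimes> inv g)"
      using that assms(2) by (simp add: inv_mult_group m_assoc)
    then show ?thesis
      using that subgroup.m_inv_closed[OF assms(1)] by simp
  qed
  show "x \<otimes> y \<in> ?H" if x: "x \<in> ?H" and y: "y \<in> ?H" for x y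
  proof -
    have "g \<otimes> (x \<otimes> y) \<otimes> inv g = (g \<otimes> x \<otimes> inv g) \<otimes> (g \<otimes> y \<otimes> inv g)"
      using x y assms(2) by (simp add: m_assoc inv_mult_cancel_left)
    then show ?thesis
      using x y subgroup.m_closed[OF assms(1)] by simp
  qed
qed simp

lemma conj_preimage_conj_preimage:
  assumes "H \<subseteq> carrier G" "g \<in> carrier G"
  shows "{y \<in> carrier G. g \<otimes> y \<otimes> inv g \<in> {y \<in> carrier G. inv g \<otimes> y \<otimes> inv (inv g) \<in> H}} = H"
proof -
  have "inv g \<otimes> (g \<otimes> y \<otimes> inv g) \<otimes> inv (inv g) = y" if "y \<in> carrier G" for y
    using that assms(2) by (simp add: m_assoc inv_mult_cancel_left)
  then show ?thesis
    using assms by auto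
qed

text \<open>Taking preimages under conjugation by \<open>g\<close> permutes the subgroups and
  preserves inclusion, and the same for \<open>inv g\<close> undoes it, so maximality carries
  over.\<close>

lemma maximal_subgroup_conj_preimage:
  assumes "maximal_subgroup M G" "g \<in> carrier G"
  shows "maximal_subgroup {y \<in> carrier G. g \<otimes> y \<otimes> inv g \<in> M} G"
proof -
  define c where "c = (\<lambda>g H. {y \<in> carrier G. g \<otimes> y \<otimes> inv g \<in> H})"
  have M: "subgroup M G" "M \<noteq> carrier G"
    and max: "\<And>H. subgroup H G \<Longrightarrow> M \<subseteq> H \<Longrightarrow> H = M \<or> H = carrier G"
    using assms(1) by (auto simp: maximal_subgroup_def)
  have mono: "c h H \<subseteq> c h H'" if "H \<subseteq> H'" for h H H'
    using that by (auto simp: c_def)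
  have carrier: "c h (carrier G) = carrier G" if "h \<in> carrier G" for h
    using that by (auto simp: c_def)
  have c_c: "c h (c (inv h) H) = H" if "H \<subseteq> carrier G" "h \<in> carrier G" for h H
    using that unfolding c_def by (rule conj_preimage_conj_preimage)
  have c_c': "c (inv g) (c g H) = H" if "H \<subseteq> carrier G" for H
    using c_c[OF that inv_closed[OF assms(2)]] by (simp only: inv_inv[OF assms(2)])
  have sub: "subgroup (c h H) G" if "subgroup H G" "h \<in> carrier G" for h H
    using that unfolding c_def by (rule conj_subgroup_preimage)
  have "c g M \<noteq> carrier G"
    using M(2) c_c'[OF subgroup.subset[OF M(1)]] carrier[OF inv_closed[OF assms(2)]] by metis
  moreover have "H = c g M \<or> H = carrier G" if H: "subgroup H G" "c g M \<subseteq> H" for H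
  proof -
    have "M \<subseteq> c (inv g) H"
      using mono[OF H(2), of "inv g"] c_c'[OF subgroup.subset[OF M(1)]] by simp
    then have "c (inv g) H = M \<or> c (inv g) H = carrier G"
      using max sub[OF H(1) inv_closed[OF assms(2)]] by blast
    then show ?thesis
      using c_c[OF subgroup.subset[OF H(1)] assms(2)] carrier[OF assms(2)] by metis
  qed
  ultimately have "maximal_subgroup (c g M) G"
    using sub[OF M(1) assms(2)] unfolding maximal_subgroup_def by blast
  then show ?thesis
    by (simp only: c_def)
qed

text \<open>A conjugate of \<open>h\<close> lies in \<open>M\<close> as soon as \<open>h\<close>
  lies in the corresponding conjugate of \<open>M\<close>, which is again maximal.\<close>

lemma normal_frattini_subgroup: "frattini_subgroup G \<lhd> G"
  unfolding normal_inv_iff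
proof (intro conjI ballI)
  have sub: "subgroup M G" if "maximal_subgroup M G" for M
    using that by (simp add: maximal_subgroup_def)
  show "subgroup (frattini_subgroup G) G"
  proof (rule subgroupI)
    show "frattini_subgroup G \<noteq> {}"
      using subgroup.one_closed[OF sub] by (auto simp: frattini_subgroup_def)
  qed (auto simp: frattini_subgroup_def dest: sub intro: subgroup.m_inv_closed subgroup.m_closed)
  show "x \<otimes> h \<otimes> inv x \<in> frattini_subgroup G"
    if "x \<in> carrier G" "h \<in> frattini_subgroup G" for x h
    using that maximal_subgroup_conj_preimage by (fastforce simp: frattini_subgroup_def)
qed

end

section \<open>Proper subgroups containing a power of the translation\<close>

context nontorsion_sunic
begin

text \<open>Odd powers of \<open>\<tau>\<close> move the first letter, and
  \<open>\<tau> ^^ (2 * i)\<close> has the section \<open>\<tau> ^^ i\<close> at the letter 1, which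
  fixes the same ray. So the exponent can be halved until it is 0.\<close>

lemma tau_pow_eq_id_if_fixes_ray:
  "(\<And>n. (\<tau> ^^ j) (replicate n True) = replicate n True) \<Longrightarrow> j = 0"
proof (induction j rule: less_induct)
  case (less j)
  have double: "\<tau> ^^ (2 * i) = pair (\<sigma> ^^ i) (\<tau> ^^ i)" for i
    by (simp only: funpow_double tau_tau pair_funpow)
  show ?case
  proof (cases "even j")
    case True
    then obtain i where i: "j = 2 * i" by blast
    have "(\<tau> ^^ i) (replicate n True) = replicate n True" for n
      using less.prems[of "Suc n"] unfolding i double by simp
    then show ?thesis
      using less.IH[of i] i by (cases "i = 0") auto
  next
    case False
    then obtain i where i: "j = Suc (2 * i)"
      by (metis oddE Suc_eq_plus1)
    have "(\<tau> ^^ j) [True] = \<tau> [True]"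
      unfolding i by (simp add: double funpow_closed tau_in_G)
    also have "\<dots> = [False]"
      by (simp add: \<tau>_def)
    finally show ?thesis
      using less.prems[of 1] by simp
  qed
qed

section \<open>The orbit of the ray 111... and its stabilizers\<close>

lemma act_B_replicate_True [simp]: "act_B f x (replicate n True) = replicate n True"
  by (induction n arbitrary: x) auto

text \<open>Below the first letter 0 of a word, an element of \<open>B\<close> acts as
  \<open>a\<close> or trivially, according to its current bit; for \<open>\<beta>\<close> the bit is
  always 1.\<close>

lemma act_B_eq_id_or_beta: "act_B f x w = w \<or> act_B f x w = \<beta> w"
proof (induction w arbitrary: x)
  case (Cons l w)
  have "\<beta> (l # w) = pair swap_first \<beta> (l # w)"
    using beta_eq_pair by simp
  then show ?case
    using Cons[of "rho f x"] by (cases l) (auto simp: act_A_def)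
qed simp

text \<open>The points \<open>\<tau>\<^sup>k(111\<dots>)\<close> of the boundary of the tree with \<open>k \<in> q\<int>\<close>, a point being
  represented by the sequence of its finite prefixes.\<close>

definition orbit :: "nat \<Rightarrow> (nat \<Rightarrow> vertex) set" where
  "orbit q = {p. \<exists>k. q dvd k \<and> (p = (\<lambda>n. (\<tau> ^^ k) (replicate n True))
    \<or> p = (\<lambda>n. (\<sigma> ^^ k) (replicate n True)))}"

text \<open>\<open>\<beta>\<close> fixes the ray 111... and inverts the translation, so it exchanges
  the points with exponents \<open>k\<close> and \<open>-k\<close>.\<close>

lemma beta_orbit: "p \<in> orbit q \<Longrightarrow> \<beta> \<circ> p \<in> orbit q"
  by (auto simp: orbit_def fun_eq_iff sigma_pow')

lemma orbit_take:
  assumes "p \<in> orbit q" "n \<le> n'"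
  shows "p n = take n (p n')"
proof -
  obtain g where g: "g \<in> G" "p = (\<lambda>n. g (replicate n True))"
    using assms(1) funpow_closed tau_in_G sigma_in_G by (auto simp: orbit_def)
  have "take n (replicate n' True) = replicate n True"
    using assms(2) by (simp add: min_absorb1)
  then show ?thesis
    using apply_take[OF g(1), of n "replicate n' True"] unfolding g(2) by simp
qed

text \<open>Which of the two cases occurs could depend on the prefix. But a ray that is moved has
  all its long prefixes moved, so \<open>x\<close> acts on them as \<open>\<beta>\<close>, and
  truncation transfers this to the short ones.\<close>

lemma act_B_orbit:
  assumes "x \<in> B" "p \<in> orbit q"
  shows "act_B f x \<circ> p \<in> orbit q"
proof (cases "act_B f x \<circ> p = p")
  case False
  then obtain m where m: "act_B f x (p m) \<noteq> p m"
    by (auto simp: fun_eq_iff)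
  note take_x = apply_take[OF gens_in_G(2)[OF assms(1)]]
  have large: "act_B f x (p n) = \<beta> (p n)" if "n \<ge> m" for n
  proof -
    have "act_B f x (p n) \<noteq> p n"
      using m take_x[of m "p n"] orbit_take[OF assms(2) that] by auto
    then show ?thesis
      using act_B_eq_id_or_beta by blast
  qed
  have "act_B f x (p n) = \<beta> (p n)" for n
  proof (cases "n \<ge> m")
    case False
    then show ?thesis
      using large[of m] take_x[of n "p m"] apply_take[OF beta_in_G, of n "p m"]
        orbit_take[OF assms(2), of n m] by simp
  qed (rule large)
  then have "act_B f x \<circ> p = \<beta> \<circ> p" by auto
  then show ?thesis
    using beta_orbit[OF assms(2)] by simp
qed (use assms in simp)

lemma tau_pow_sigma_pow_le:
  assumes "m \<le> n"
  shows "(\<tau> ^^ m) ((\<sigma> ^^ n) w) = (\<sigma> ^^ (n - m)) w"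
proof -
  have "\<sigma> ^^ n = \<sigma> ^^ m \<circ> \<sigma> ^^ (n - m)"
    using assms by (simp flip: funpow_add)
  then show ?thesis by simp
qed

lemma tau_pow_orbit:
  assumes "p \<in> orbit q"
  shows "\<tau> ^^ q \<circ> p \<in> orbit q"
proof -
  obtain k where "q dvd k"
    and "p = (\<lambda>n. (\<tau> ^^ k) (replicate n True)) \<or> p = (\<lambda>n. (\<sigma> ^^ k) (replicate n True))"
    using assms by (auto simp: orbit_def)
  from this(2) show ?thesis
  proof
    assume "p = (\<lambda>n. (\<tau> ^^ k) (replicate n True))"
    then have "\<tau> ^^ q \<circ> p = (\<lambda>n. (\<tau> ^^ (q + k)) (replicate n True))"
      by (simp add: funpow_add comp_def)
    moreover have "q dvd q + k"
      using \<open>q dvd k\<close> by simp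
    ultimately show ?thesis
      unfolding orbit_def by blast
  next
    assume p: "p = (\<lambda>n. (\<sigma> ^^ k) (replicate n True))"
    show ?thesis
    proof (cases "q \<le> k")
      case True
      then have "\<tau> ^^ q \<circ> p = (\<lambda>n. (\<sigma> ^^ (k - q)) (replicate n True))"
        unfolding p by (auto simp: tau_pow_sigma_pow_le)
      moreover have "q dvd k - q"
        using \<open>q dvd k\<close> by simp
      ultimately show ?thesis
        unfolding orbit_def by blast
    next
      \<comment> \<open>As \<open>q\<close> divides \<open>k\<close>, the shift by \<open>q\<close>
        passes from exponents at most 0 to positive ones only at \<open>k = 0\<close>.\<close>
      case False
      then have "k = 0"
        using \<open>q dvd k\<close> by (auto dest: dvd_imp_le)
      then have "\<tau> ^^ q \<circ> p = (\<lambda>n. (\<tau> ^^ q) (replicate n True))"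
        unfolding p by auto
      moreover have "q dvd q" by simp
      ultimately show ?thesis
        unfolding orbit_def by blast
    qed
  qed
qed

text \<open>Invariance is demanded for \<open>inv_G g\<close> as well, since mapping an infinite set
  into itself does not imply mapping it onto itself.\<close>

definition orbit_stabilizer :: "nat \<Rightarrow> (vertex \<Rightarrow> vertex) set" where
  "orbit_stabilizer q = {g \<in> G. \<forall>p\<in>orbit q. g \<circ> p \<in> orbit q \<and> inv_G g \<circ> p \<in> orbit q}"

lemma subgroup_orbit_stabilizer: "subgroup (orbit_stabilizer q) (sunic_group f)"
proof (rule G.subgroupI)
  have "id \<in> orbit_stabilizer q"
    unfolding orbit_stabilizer_def using G.one_closed
    by (simp only: G.inv_one mem_Collect_eq id_comp) blast
  then show "orbit_stabilizer q \<noteq> {}" by blast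
  show "g \<circ> h \<in> orbit_stabilizer q" if "g \<in> orbit_stabilizer q" "h \<in> orbit_stabilizer q" for g h
    using that unfolding orbit_stabilizer_def
    by (simp only: mem_Collect_eq inv_comp comp_assoc G.m_closed) blast
qed (auto simp: orbit_stabilizer_def G.inv_inv)

lemma act_B_in_orbit_stabilizer: "x \<in> B \<Longrightarrow> act_B f x \<in> orbit_stabilizer q"
  by (simp add: orbit_stabilizer_def gens_in_G inv_act_B act_B_orbit)

lemma tau_pow_in_orbit_stabilizer: "\<tau> ^^ q \<in> orbit_stabilizer q"
proof -
  have "\<sigma> ^^ q \<circ> \<tau> ^^ q = id" by auto
  then have inv: "inv_G (\<tau> ^^ q) = \<sigma> ^^ q"
    by (rule inv_G_eqI[OF funpow_closed[OF tau_in_G]])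
  have "\<sigma> ^^ q \<circ> p \<in> orbit q" if "p \<in> orbit q" for p
    using beta_orbit[OF tau_pow_orbit[OF beta_orbit[OF that]]]
    by (simp only: sigma_pow' comp_assoc)
  then show ?thesis
    by (simp add: orbit_stabilizer_def funpow_closed tau_in_G inv tau_pow_orbit)
qed

text \<open>The translation acts freely on the orbit, so \<open>\<tau>\<close> could send the ray
  111... into \<open>orbit q\<close> only if \<open>q\<close> divided 1.\<close>

lemma tau_notin_orbit_stabilizer:
  assumes "q \<ge> 2"
  shows "\<tau> \<notin> orbit_stabilizer q"
proof
  assume "\<tau> \<in> orbit_stabilizer q"
  moreover have "(\<lambda>n. replicate n True) \<in> orbit q"
    unfolding orbit_def by (auto intro!: exI[of _ 0])
  ultimately have "\<tau> \<circ> (\<lambda>n. replicate n True) \<in> orbit q"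
    by (simp only: orbit_stabilizer_def mem_Collect_eq)
  then obtain k where "q dvd k"
    and "(\<forall>n. \<tau> (replicate n True) = (\<tau> ^^ k) (replicate n True))
      \<or> (\<forall>n. \<tau> (replicate n True) = (\<sigma> ^^ k) (replicate n True))"
    by (auto simp: orbit_def fun_eq_iff)
  from this(2) show False
  proof
    assume eq: "\<forall>n. \<tau> (replicate n True) = (\<tau> ^^ k) (replicate n True)"
    show False
    proof (cases k)
      case 0
      then have "(\<tau> ^^ 1) (replicate n True) = replicate n True" for n
        using eq by simp
      then show False
        using tau_pow_eq_id_if_fixes_ray[of 1] by simp
    next
      case (Suc j)
      have "(\<tau> ^^ j) (replicate n True) = replicate n True" for n
      proof -
        have "\<sigma> (\<tau> (replicate n True)) = \<sigma> (\<tau> ((\<tau> ^^ j) (replicate n True)))"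
          using eq Suc by simp
        then show ?thesis by simp
      qed
      then have "j = 0"
        by (rule tau_pow_eq_id_if_fixes_ray)
      then show False
        using Suc \<open>q dvd k\<close> assms by simp
    qed
  next
    assume eq: "\<forall>n. \<tau> (replicate n True) = (\<sigma> ^^ k) (replicate n True)"
    have "(\<tau> ^^ Suc k) (replicate n True) = replicate n True" for n
    proof -
      have "(\<tau> ^^ Suc k) (replicate n True) = (\<tau> ^^ k) (\<tau> (replicate n True))"
        by (simp add: funpow_swap1)
      then show ?thesis
        using eq by simp
    qed
    then show False
      using tau_pow_eq_id_if_fixes_ray[of "Suc k"] by blast
  qed
qed

section \<open>Maximal subgroups avoiding the translation\<close>

lemma subgroup_eq_G:
  assumes M: "subgroup M (sunic_group f)" and "\<tau> \<in> M" and B: "\<And>x. x \<in> B \<Longrightarrow> act_B f x \<in> M"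
  shows "M = G"
proof
  show "M \<subseteq> G"
    by (rule subgroup.subset[OF M])
  note comp = G.subgroupE(4)[OF M]
  have "\<tau> \<circ> \<beta> \<in> M"
    by (rule comp[OF \<open>\<tau> \<in> M\<close> B[OF e_in_B]])
  moreover have "\<tau> \<circ> \<beta> = swap_first"
    by (auto simp: \<tau>_def)
  ultimately have swap: "swap_first \<in> M" by simp
  have "id \<in> M"
    using subgroup.one_closed[OF M] by (simp only: one_eq_id)
  show "G \<subseteq> M"
  proof
    fix g assume "g \<in> G"
    then show "g \<in> M"
    proof (induction rule: sunic_induct)
      case id
      show ?case by fact
    next
      case (swap g)
      show ?case by (rule comp[OF \<open>swap_first \<in> M\<close> swap.IH])
    next
      case (act_B x g)
      show ?case by (rule comp[OF B[OF act_B.hyps(1)] act_B.IH])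
    qed
  qed
qed

text \<open>Zorn's lemma gives a subgroup \<open>M\<close> above \<open>H\<close> that is maximal
  among those avoiding \<open>\<tau>\<close>. Any larger subgroup contains \<open>\<tau>\<close> and
  the action of \<open>B\<close>, which together generate \<open>G\<close>, so \<open>M\<close> is
  maximal outright.\<close>

lemma ex_maximal_subgroup:
  assumes H: "subgroup H (sunic_group f)" "\<tau> \<notin> H" and B: "\<And>x. x \<in> B \<Longrightarrow> act_B f x \<in> H"
  shows "\<exists>M. maximal_subgroup M (sunic_group f) \<and> H \<subseteq> M \<and> \<tau> \<notin> M"
proof -
  let ?A = "{M. subgroup M (sunic_group f) \<and> H \<subseteq> M \<and> \<tau> \<notin> M}"
  have "\<exists>M\<in>?A. \<forall>X\<in>?A. M \<subseteq> X \<longrightarrow> X = M"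
  proof (rule subset_Zorn_nonempty)
    show "?A \<noteq> {}"
      using H by blast
    fix C assume "C \<noteq> {}" and chain: "subset.chain ?A C"
    then have C: "\<And>M. M \<in> C \<Longrightarrow> subgroup M (sunic_group f)" "\<And>M. M \<in> C \<Longrightarrow> H \<subseteq> M \<and> \<tau> \<notin> M"
      and linear: "\<And>M M'. M \<in> C \<Longrightarrow> M' \<in> C \<Longrightarrow> M \<subseteq> M' \<or> M' \<subseteq> M"
      by (auto simp: subset_chain_def)
    have "subgroup (\<Union>C) (sunic_group f)"
    proof (rule G.subgroupI)
      show "\<Union>C \<subseteq> G"
        using subgroup.subset[OF C(1)] by blast
      show "\<Union>C \<noteq> {}"
        using \<open>C \<noteq> {}\<close> subgroup.one_closed[OF C(1)] by blast
      show "inv_G x \<in> \<Union>C" if "x \<in> \<Union>C" for x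
        using that G.subgroupE(3)[OF C(1)] by blast
      show "x \<circ> y \<in> \<Union>C" if xy: "x \<in> \<Union>C" "y \<in> \<Union>C" for x y
      proof -
        obtain M M' where "M \<in> C" "x \<in> M" "M' \<in> C" "y \<in> M'"
          using xy by blast
        then obtain L where "L \<in> C" "x \<in> L" "y \<in> L"
          using linear[of M M'] by blast
        then show ?thesis
          using G.subgroupE(4)[OF C(1)] by blast
      qed
    qed
    then show "\<Union>C \<in> ?A"
      using C(2) \<open>C \<noteq> {}\<close> by blast
  qed
  then obtain M where "M \<in> ?A" and max: "\<forall>X\<in>?A. M \<subseteq> X \<longrightarrow> X = M" ..
  then have M: "subgroup M (sunic_group f)" "H \<subseteq> M" "\<tau> \<notin> M"
    by simp_all
  have "X = M \<or> X = G" if "subgroup X (sunic_group f)" "M \<subseteq> X" for X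
  proof (cases "\<tau> \<in> X")
    case True
    then have "X = G"
      by (rule subgroup_eq_G[OF that(1)]) (use B M(2) that(2) in blast)
    then show ?thesis ..
  next
    case False
    then have "X \<in> ?A"
      using that M(2) by simp
    then show ?thesis
      using max that(2) by simp
  qed
  moreover have "M \<noteq> G"
    using M(3) tau_in_G by blast
  ultimately have "maximal_subgroup M (sunic_group f)"
    using M(1) unfolding maximal_subgroup_def by blast
  then show ?thesis
    using M by blast
qed

lemma frattini_subgroup_trivial: "frattini_subgroup (sunic_group f) = {id}"
proof (rule ccontr)
  let ?F = "frattini_subgroup (sunic_group f)"
  assume "?F \<noteq> {id}"
  note F = G.normal_frattini_subgroup
  have "id \<in> ?F"
    by (rule normalD(2)[OF F])
  then obtain g where "g \<in> ?F" "g \<noteq> id"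
    using \<open>?F \<noteq> {id}\<close> by blast
  then obtain k where "k > 0" and k: "\<tau> ^^ k \<in> ?F"
    using tau_pow_in_normal[OF F] by blast
  then have "\<tau> \<notin> orbit_stabilizer (Suc k)"
    by (intro tau_notin_orbit_stabilizer) simp
  then obtain M where max: "maximal_subgroup M (sunic_group f)"
    and M: "orbit_stabilizer (Suc k) \<subseteq> M" "\<tau> \<notin> M"
    using ex_maximal_subgroup[OF subgroup_orbit_stabilizer] act_B_in_orbit_stabilizer by blast
  have sub: "subgroup M (sunic_group f)"
    using max by (simp add: maximal_subgroup_def)
  have "\<tau> ^^ k \<in> M"
    using k max by (auto simp: frattini_subgroup_def)
  moreover have "\<tau> ^^ Suc k \<in> M"
    using M(1) tau_pow_in_orbit_stabilizer by blast
  ultimately have "\<tau> ^^ Suc k \<circ> inv_G (\<tau> ^^ k) \<in> M"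
    using G.subgroupE(3,4)[OF sub] by blast
  moreover have "\<tau> ^^ Suc k \<circ> inv_G (\<tau> ^^ k) = \<tau>"
    using funpow_closed[OF tau_in_G, of k] by (simp add: comp_assoc G.r_inv)
  ultimately show False
    using M(2) by simp
qed

end

theorem corollary1p5:
  fixes f :: "bit poly"
  assumes "sunic_poly f"
    and "\<exists>g\<in>carrier (sunic_group f).
           \<forall>n::nat. n > 0 \<longrightarrow> g [^]\<^bsub>sunic_group f\<^esub> n \<noteq> \<one>\<^bsub>sunic_group f\<^esub>"
    and "\<not> sunic_group f \<cong> infinite_dihedral_group"
  shows "frattini_subgroup (sunic_group f) = {\<one>\<^bsub>sunic_group f\<^esub>}"
proof -
  interpret sunic f
    using assms(1) by unfold_locales
  obtain e where "e \<in> B" "\<And>j. omega f ((rho f ^^ j) e) = 1"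
    using ex_always_swapping[OF assms(2)] by blast
  then interpret nontorsion_sunic f e
    by unfold_locales
  show ?thesis
    using frattini_subgroup_trivial by (simp only: one_eq_id)
qed

end
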